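(* Let $p,p'$ be integers with $1<p<p'<2p$ and $\gcd(p,p')=1$, and let integers $1\le r<p$ and $1\le s<p'$ be fixed by $|p'r-ps|=1$. Let $d''$, $\mathcal I''$ and $B''$ be the integer and the $d''\times d''$ matrices attached to the continued fraction expansion of $p'/p$ as described in the context. Then for every $L\in\mathbb Z$, $$\sum_{m} q^{\frac12 mB''m}\prod_{j=1}^{d''}\genfrac{[}{]}{0pt}{}{L\delta_{j,1}+\frac12(\mathcal I''m)_j}{m_j}$$ $$=\sum_{j=-\infty}^{\infty}\Bigl\{q^{j(p'(p+p')j+1)}\genfrac{[}{]}{0pt}{}{L}{2p'j}_2-q^{(p'j+s)((p+p')j+r+s)}\genfrac{[}{]}{0pt}{}{L}{2p'j+2s}_2\Bigr\},$$ where the left-hand sum is over all $m\in\mathbb Z^{d''}$ such that $m_1+m_2$ and $m_3,\dots,m_{d''}$ are all even.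
   Context: $q$ is an indeterminate. $(q)_0=1$, $(q)_n=\prod_{j=1}^n(1-q^j)$ for $n\ge1$. $\genfrac{[}{]}{0pt}{}{n}{a}=\frac{(q)_n}{(q)_a(q)_{n-a}}$ if $0\le a\le n$, and $0$ otherwise (in particular $0$ if $n<0$). The $q$-trinomial coefficients are $$\genfrac{[}{]}{0pt}{}{L,b}{a}_2=\sum_{k\ge0}q^{k(k+b)}\genfrac{[}{]}{0pt}{}{L}{k}\genfrac{[}{]}{0pt}{}{L-k}{k+a},\qquad \genfrac{[}{]}{0pt}{}{L}{a}_2=\genfrac{[}{]}{0pt}{}{L,a}{a}_2 .$$ Matrices. Write the continued fraction expansion $\frac{p'}{p}=[\nu_0,\dots,\nu_{n-1},\nu_n+2]=\nu_0+1/(\nu_1+1/(\cdots+1/(\nu_n+2)))$ with integers $n\ge0$, $\nu_0,\dots,\nu_{n-1}\ge1$, $\nu_n\ge0$ (here $n\geq 1$ and $\nu_0=1$ because $1<p'/p<2$). Put $t_m=\sum_{j=0}^{m-1}\nu_j$ for $1\le m\le n$ and $d'=\sum_{j=0}^n\nu_j$. The $d'\times d'$ matrix $\mathcal I'$ has entries $$\mathcal I'_{i,j}=\begin{cases}\delta_{i,j+1}+\delta_{i,j-1} & \text{for } 1\le i<d',\ i\ne t_m,\\ \delta_{i,j+1}+\delta_{i,j}-\delta_{i,j-1} & \text{for } i=t_m,\ 1\le m\le n-\delta_{\nu_n,0},\\ \delta_{i,j+1}+\delta_{\nu_n,0}\,\delta_{i,j} & \text{for } i=d'.\end{cases}$$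 Put $d''=d'+1$. The $d''\times d''$ matrix $\mathcal I''$ has entries $$\mathcal I''_{i,j}=\begin{cases}-\delta_{i,1}\delta_{j,1}+\delta_{i,2}+\delta_{i,3}-\delta_{j,2}+\delta_{j,3} & \text{for } i=1\text{ or }j=1,\\ \mathcal I'_{i-1,j-1} & \text{for } i,j=2,\dots,d'',\end{cases}$$ and $B''$ is defined by $2B''=2I-\mathcal I''$ with $I$ the identity matrix. Notation: $mB''m=\sum_{j,k}m_jB''_{j,k}m_k$ and $(\mathcal I''m)_j=\sum_k\mathcal I''_{j,k}m_k$. *)

theory Defs
  imports "HOL-Library.FuncSet" "HOL-Computational_Algebra.Formal_Laurent_Series"
begin

definition q_fact :: "'a::field \<Rightarrow> nat \<Rightarrow> 'a" where
  "q_fact q n = (\<Prod>j=1..n. 1 - q ^ j)"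

definition q_binom :: "'a::field \<Rightarrow> int \<Rightarrow> int \<Rightarrow> 'a" where
  "q_binom q n a =
     (if 0 \<le> a \<and> a \<le> n then q_fact q (nat n) / (q_fact q (nat a) * q_fact q (nat (n - a))) else 0)"

text \<open>The defining sum is over all \<open>k \<ge> 0\<close>; its terms with \<open>k > L\<close> vanish.\<close>

definition q_trinom2 :: "'a::field \<Rightarrow> int \<Rightarrow> int \<Rightarrow> int \<Rightarrow> 'a" where
  "q_trinom2 q L b a =
     (\<Sum>k=0..L. q powi (k * (k + b)) * q_binom q L k * q_binom q (L - k) (k + a))"

abbreviation q_trinom :: "'a::field \<Rightarrow> int \<Rightarrow> int \<Rightarrow> 'a" where
  "q_trinom q L a \<equiv> q_trinom2 q L a a"

text \<open>\<open>cfrac \<nu> n\<close> is the value of \<open>[\<nu> 0, \<dots>, \<nu> (n-1), \<nu> n + 2]\<close>; note the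
  \<open>+ 2\<close> in the last partial quotient.\<close>

fun cfrac :: "(nat \<Rightarrow> nat) \<Rightarrow> nat \<Rightarrow> rat" where
  "cfrac \<nu> 0 = of_nat (\<nu> 0 + 2)"
| "cfrac \<nu> (Suc n) = of_nat (\<nu> 0) + 1 / cfrac (\<lambda>i. \<nu> (Suc i)) n"

definition cfrac_expansion :: "rat \<Rightarrow> nat \<Rightarrow> (nat \<Rightarrow> nat) \<Rightarrow> bool" where
  "cfrac_expansion x n \<nu> \<longleftrightarrow> (\<forall>i<n. 1 \<le> \<nu> i) \<and> x = cfrac \<nu> n"

text \<open>All matrices are functions of two indices, which range over \<open>{1..d}\<close>.\<close>

abbreviation delta :: "nat \<Rightarrow> nat \<Rightarrow> int" where
  "delta i j \<equiv> of_bool (i = j)"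

definition tpos :: "(nat \<Rightarrow> nat) \<Rightarrow> nat \<Rightarrow> nat" where
  "tpos \<nu> m = (\<Sum>j<m. \<nu> j)"

definition dim1 :: "nat \<Rightarrow> (nat \<Rightarrow> nat) \<Rightarrow> nat" where
  "dim1 n \<nu> = (\<Sum>j\<le>n. \<nu> j)"

text \<open>The term \<open>\<delta>\<^bsub>i,j-1\<^esub>\<close> is written \<open>delta (i + 1) j\<close> because subtraction
  on \<^typ>\<open>nat\<close> truncates. For a continued fraction expansion no \<open>tpos \<nu> m\<close> in the second case
  equals \<open>dim1 n \<nu>\<close>, so the order of the cases is immaterial.\<close>

definition I1 :: "nat \<Rightarrow> (nat \<Rightarrow> nat) \<Rightarrow> nat \<Rightarrow> nat \<Rightarrow> int" where
  "I1 n \<nu> i j =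
     (if i = dim1 n \<nu> then delta i (j + 1) + delta (\<nu> n) 0 * delta i j
      else if \<exists>m\<in>{1..n - of_bool (\<nu> n = 0)}. i = tpos \<nu> m
        then delta i (j + 1) + delta i j - delta (i + 1) j
      else delta i (j + 1) + delta (i + 1) j)"

definition dim2 :: "nat \<Rightarrow> (nat \<Rightarrow> nat) \<Rightarrow> nat" where
  "dim2 n \<nu> = dim1 n \<nu> + 1"

definition I2 :: "nat \<Rightarrow> (nat \<Rightarrow> nat) \<Rightarrow> nat \<Rightarrow> nat \<Rightarrow> int" where
  "I2 n \<nu> i j =
     (if i = 1 \<or> j = 1 then - (delta i 1 * delta j 1) + delta i 2 + delta i 3 - delta j 2 + delta j 3
      else I1 n \<nu> (i - 1) (j - 1))"

definition B2 :: "nat \<Rightarrow> (nat \<Rightarrow> nat) \<Rightarrow> nat \<Rightarrow> nat \<Rightarrow> rat" where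
  "B2 n \<nu> i j = (2 * of_int (delta i j) - of_int (I2 n \<nu> i j)) / 2"

definition I2_vec :: "nat \<Rightarrow> (nat \<Rightarrow> nat) \<Rightarrow> (nat \<Rightarrow> int) \<Rightarrow> nat \<Rightarrow> int" where
  "I2_vec n \<nu> m j = (\<Sum>k=1..dim2 n \<nu>. I2 n \<nu> j k * m k)"

definition B2_form :: "nat \<Rightarrow> (nat \<Rightarrow> nat) \<Rightarrow> (nat \<Rightarrow> int) \<Rightarrow> rat" where
  "B2_form n \<nu> m =
     (\<Sum>j=1..dim2 n \<nu>. \<Sum>k=1..dim2 n \<nu>. of_int (m j) * B2 n \<nu> j k * of_int (m k))"

definition m_index :: "nat \<Rightarrow> (nat \<Rightarrow> nat) \<Rightarrow> (nat \<Rightarrow> int) set" where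
  "m_index n \<nu> =
     {m \<in> {1..dim2 n \<nu>} \<rightarrow>\<^sub>E UNIV. even (m 1 + m 2) \<and> (\<forall>j\<in>{3..dim2 n \<nu>}. even (m j))}"

text \<open>If \<open>\<nu>\<close> expands a number below 2 and \<open>m \<in> m_index n \<nu>\<close>, then \<open>I2_vec n \<nu> m j\<close> is
  even (\<open>even_I2_vec\<close>) and \<open>B2_form n \<nu> m / 2\<close> is an integer (\<open>half_B2_form_integral\<close>): neither
  the floor nor \<open>div\<close> rounds.\<close>

definition fermi_term :: "'a::field \<Rightarrow> nat \<Rightarrow> (nat \<Rightarrow> nat) \<Rightarrow> int \<Rightarrow> (nat \<Rightarrow> int) \<Rightarrow> 'a" where
  "fermi_term q n \<nu> L m =
     q powi \<lfloor>B2_form n \<nu> m / 2\<rfloor> *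
     (\<Prod>j=1..dim2 n \<nu>. q_binom q (L * delta j 1 + I2_vec n \<nu> m j div 2) (m j))"

definition bose_term :: "'a::field \<Rightarrow> int \<Rightarrow> int \<Rightarrow> int \<Rightarrow> int \<Rightarrow> int \<Rightarrow> int \<Rightarrow> 'a" where
  "bose_term q p p' r s L j =
     q powi (j * (p' * (p + p') * j + 1)) * q_trinom q L (2 * p' * j)
     - q powi ((p' * j + s) * ((p + p') * j + r + s)) * q_trinom q L (2 * p' * j + 2 * s)"

subsection \<open>Well-definedness\<close>

text \<open>Both sides of the identity sum \<open>fermi_term\<close> over \<open>m_index\<close> and \<open>bose_term\<close> over all
  integers with the library's \<open>sum'\<close>, which sums over the support if that is finite; it always
  is, by \<open>finite_fermi_support\<close> and \<open>finite_bose_support\<close>.\<close>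

lemma cfrac_gt_1:
  assumes "\<forall>i<n. 1 \<le> \<nu> i" shows "1 < cfrac \<nu> n"
  using assms
proof (induction n arbitrary: \<nu>)
  case (Suc n)
  have "1 < cfrac (\<lambda>i. \<nu> (Suc i)) n" using Suc.prems by (intro Suc.IH) auto
  hence "0 < 1 / cfrac (\<lambda>i. \<nu> (Suc i)) n" by simp
  moreover have "of_nat 1 \<le> (of_nat (\<nu> 0) :: rat)"
    using Suc.prems by (subst of_nat_le_iff) auto
  ultimately show ?case unfolding cfrac.simps of_nat_1 by linarith
qed auto

lemma cfrac_expansion_exists:
  assumes "(1::rat) < x" shows "\<exists>n \<nu>. cfrac_expansion x n \<nu>"
proof -
  have "\<exists>n \<nu>. cfrac_expansion (of_nat a / of_nat b) n \<nu>" if "0 < b" "b < a" for a b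
    using that
  proof (induction b arbitrary: a rule: less_induct)
    case (less b)
    define r where "r = a mod b"
    define c where "c = a div b"
    have a: "a = c * b + r" by (simp add: r_def c_def)
    have "r < b" using less.prems by (simp add: r_def)
    have "1 \<le> c" using less.prems by (metis c_def div_less_iff_less_mult less_one mult_1 not_le less_imp_le_nat)
    show ?case
    proof (cases "r = 0")
      case True
      hence "of_nat a / of_nat b = (of_nat c :: rat)" using a less.prems by simp
      moreover have "c \<noteq> 1" using a True less.prems by auto
      with \<open>1 \<le> c\<close> have "2 \<le> c" by simp
      hence "cfrac (\<lambda>_. c - 2) 0 = of_nat c" by (simp add: of_nat_diff)
      ultimately show ?thesis unfolding cfrac_expansion_def
        by (intro exI[of _ 0] exI[of _ "\<lambda>_. c - 2"]) simp
    next
      case False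
      obtain n \<nu> where n: "cfrac_expansion (of_nat b / of_nat r) n \<nu>"
        using less.IH[of r b] False \<open>r < b\<close> by auto
      have "of_nat a / of_nat b = of_nat c + 1 / (of_nat b / of_nat r :: rat)"
        using a False less.prems by (simp add: field_simps)
      thus ?thesis using n \<open>1 \<le> c\<close> unfolding cfrac_expansion_def
        by (intro exI[of _ "Suc n"] exI[of _ "case_nat c \<nu>"]) (auto split: nat.splits)
    qed
  qed
  moreover obtain u v where "quotient_of x = (u, v)" by fastforce
  hence "x = of_int u / of_int v" "0 < v"
    using quotient_of_div quotient_of_denom_pos by auto
  hence "x = of_nat (nat u) / of_nat (nat v)" "0 < nat v" "nat v < nat u"
  proof -
    have "of_int v < (of_int u :: rat)"
      using \<open>x = of_int u / of_int v\<close> \<open>0 < v\<close> assms by (simp add: less_divide_eq)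
    hence "v < u" by (simp only: of_int_less_iff)
    thus "x = of_nat (nat u) / of_nat (nat v)" "0 < nat v" "nat v < nat u"
      using \<open>x = of_int u / of_int v\<close> \<open>0 < v\<close> by auto
  qed
  ultimately show ?thesis by metis
qed

lemma cfrac_expansion_lt_2:
  assumes "cfrac_expansion x n \<nu>" "x < 2"
  shows "1 \<le> n" "\<nu> 0 = 1"
proof -
  have pos: "\<forall>i<n. 1 \<le> \<nu> i" and x: "x = cfrac \<nu> n"
    using assms by (auto simp: cfrac_expansion_def)
  show n: "1 \<le> n" using x assms(2) by (cases n) auto
  then obtain k where k: "n = Suc k" by (cases n) auto
  have "1 < cfrac (\<lambda>i. \<nu> (Suc i)) k" using pos k by (intro cfrac_gt_1) auto
  hence "0 < 1 / cfrac (\<lambda>i. \<nu> (Suc i)) k" by simp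
  hence "(of_nat (\<nu> 0) :: rat) < of_nat 2"
    using x assms(2) unfolding k cfrac.simps of_nat_numeral by linarith
  hence "\<nu> 0 < 2" by (simp only: of_nat_less_iff)
  moreover have "1 \<le> \<nu> 0" using pos n by auto
  ultimately show "\<nu> 0 = 1" by simp
qed

lemma dim1_ge:
  assumes "1 \<le> n" "\<nu> 0 = 1"
  shows "1 \<le> dim1 n \<nu>" "dim1 n \<nu> = 1 \<Longrightarrow> \<nu> n = 0"
proof -
  have "(\<Sum>j\<in>{0,n}. \<nu> j) \<le> dim1 n \<nu>" unfolding dim1_def by (rule sum_mono2) auto
  thus "1 \<le> dim1 n \<nu>" "dim1 n \<nu> = 1 \<Longrightarrow> \<nu> n = 0" using assms by auto
qed

lemma I1_first_row:
  assumes "1 \<le> n" "\<nu> 0 = 1"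
  shows "I1 n \<nu> 1 j = delta j 1 - of_bool (dim1 n \<nu> \<noteq> 1) * delta j 2 + of_bool (j = 0)"
proof (cases "dim1 n \<nu> = 1")
  case True
  thus ?thesis using dim1_ge[of n \<nu>] assms by (auto simp: I1_def)
next
  case False
  have "\<nu> n = 0 \<Longrightarrow> n \<noteq> 1"
  proof
    assume "\<nu> n = 0" "n = 1"
    hence "dim1 n \<nu> = 1" using assms by (simp add: dim1_def)
    thus False using False by simp
  qed
  hence "\<exists>m\<in>{1..n - of_bool (\<nu> n = 0)}. 1 = tpos \<nu> m"
    using assms by (intro bexI[of _ 1]) (auto simp: tpos_def)
  thus ?thesis using False by (auto simp: I1_def)
qed

lemma I2_cols_parity:
  assumes "1 \<le> n" "\<nu> 0 = 1" "1 \<le> j"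
  shows "even (I2 n \<nu> j 1 + I2 n \<nu> j 2)"
proof -
  consider "j = 1" | "j = 2" | "j = 3" | "4 \<le> j" using assms(3) by linarith
  thus ?thesis
  proof cases
    case 2
    thus ?thesis using I1_first_row[of n \<nu> 1] assms(1,2) by (simp add: I2_def)
  qed (auto simp: I2_def I1_def)
qed

lemma even_I2_vec:
  assumes "cfrac_expansion x n \<nu>" "x < 2" "m \<in> m_index n \<nu>" "1 \<le> j"
  shows "even (I2_vec n \<nu> m j)"
proof -
  note n = cfrac_expansion_lt_2[OF assms(1,2)]
  have d: "2 \<le> dim2 n \<nu>" using dim1_ge(1)[of n \<nu>] n by (simp add: dim2_def)
  hence "{1..dim2 n \<nu>} = insert 1 (insert 2 {3..dim2 n \<nu>})" by auto
  hence "I2_vec n \<nu> m j = I2 n \<nu> j 1 * m 1 + I2 n \<nu> j 2 * m 2 + (\<Sum>k=3..dim2 n \<nu>. I2 n \<nu> j k * m k)"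
    by (simp add: I2_vec_def)
  moreover have "even (\<Sum>k=3..dim2 n \<nu>. I2 n \<nu> j k * m k)"
    using assms(3) by (intro dvd_sum) (auto simp: m_index_def)
  moreover have "even (m 1 + m 2)" using assms(3) by (simp add: m_index_def)
  ultimately show ?thesis using I2_cols_parity[of n \<nu> j] n assms(4) by auto
qed

lemma I2_vec_12:
  fixes m :: "nat \<Rightarrow> int"
  assumes "1 \<le> n" "\<nu> 0 = 1"
  defines "m3 \<equiv> (if 3 \<le> dim2 n \<nu> then m 3 else 0)"
  shows "I2_vec n \<nu> m 1 = - m 1 - m 2 + m3" "I2_vec n \<nu> m 2 = m 1 + m 2 - m3"
proof -
  have d: "2 \<le> dim2 n \<nu>" using dim1_ge(1)[of n \<nu>] assms(1,2) by (simp add: dim2_def)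
  have "I2_vec n \<nu> m 1 = (\<Sum>k=1..dim2 n \<nu>. (if k = 1 then - m 1 else 0)
      + (if k = 2 then - m 2 else 0) + (if k = 3 then m 3 else 0))"
    unfolding I2_vec_def by (intro sum.cong) (auto simp: I2_def)
  thus "I2_vec n \<nu> m 1 = - m 1 - m 2 + m3"
    using d unfolding sum.distrib by (simp add: m3_def)
  have "I2_vec n \<nu> m 2 = (\<Sum>k=1..dim2 n \<nu>. (if k = 1 then m 1 else 0)
      + (if k = 2 then m 2 else 0) + (if k = 3 then - m 3 else 0))"
    unfolding I2_vec_def using I1_first_row[of n \<nu>] assms(1,2)
    by (intro sum.cong) (auto simp: I2_def dim2_def)
  thus "I2_vec n \<nu> m 2 = m 1 + m 2 - m3"
    using d unfolding sum.distrib by (simp add: m3_def)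
qed

lemma B2_form_eq:
  "B2_form n \<nu> m = of_int (\<Sum>j=1..dim2 n \<nu>. m j * (2 * m j - I2_vec n \<nu> m j)) / 2"
proof -
  have "(\<Sum>k=1..dim2 n \<nu>. of_int (m j) * B2 n \<nu> j k * of_int (m k))
      = (of_int (m j * (2 * m j - I2_vec n \<nu> m j)) / 2 :: rat)" if "j \<in> {1..dim2 n \<nu>}" for j
  proof -
    have "(\<Sum>k=1..dim2 n \<nu>. of_int (m j) * B2 n \<nu> j k * of_int (m k))
        = (\<Sum>k=1..dim2 n \<nu>. (if j = k then of_int (m j) * of_int (m j) else 0)
            - of_int (m j) * of_int (I2 n \<nu> j k * m k) / (2::rat))"
      by (intro sum.cong) (auto simp: B2_def field_simps)
    also have "\<dots> = of_int (m j) * of_int (m j) - of_int (m j) * of_int (I2_vec n \<nu> m j) / 2"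
      using that by (simp add: sum_subtractf I2_vec_def sum_distrib_left sum_divide_distrib)
    finally show ?thesis by (simp add: field_simps)
  qed
  hence "B2_form n \<nu> m = (\<Sum>j=1..dim2 n \<nu>. of_int (m j * (2 * m j - I2_vec n \<nu> m j)) / 2)"
    unfolding B2_form_def by (intro sum.cong refl)
  thus ?thesis by (simp only: sum_divide_distrib of_int_sum)
qed

lemma half_B2_form_integral:
  assumes "cfrac_expansion x n \<nu>" "x < 2" "m \<in> m_index n \<nu>"
  shows "of_int \<lfloor>B2_form n \<nu> m / 2\<rfloor> = B2_form n \<nu> m / 2"
proof -
  note n = cfrac_expansion_lt_2[OF assms(1,2)]
  define m3 where "m3 = (if 3 \<le> dim2 n \<nu> then m 3 else 0)"
  note v = I2_vec_12[of n \<nu> m, OF n, folded m3_def]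
  define f where "f = (\<lambda>j. m j * (2 * m j - I2_vec n \<nu> m j))"
  have d: "2 \<le> dim2 n \<nu>" using dim1_ge(1)[of n \<nu>] n by (simp add: dim2_def)
  hence "{1..dim2 n \<nu>} = insert 1 (insert 2 {3..dim2 n \<nu>})" by auto
  hence S: "(\<Sum>j=1..dim2 n \<nu>. f j) = f 1 + f 2 + (\<Sum>j=3..dim2 n \<nu>. f j)" by simp
  have "4 dvd f j" if "j \<in> {3..dim2 n \<nu>}" for j
  proof -
    have "even (m j)" using assms(3) that by (simp add: m_index_def)
    moreover have "even (2 * m j - I2_vec n \<nu> m j)" using even_I2_vec[OF assms, of j] that by simp
    ultimately have "2 * 2 dvd f j" unfolding f_def by (rule mult_dvd_mono)
    thus ?thesis by simp
  qed
  hence 3: "4 dvd (\<Sum>j=3..dim2 n \<nu>. f j)" by (rule dvd_sum)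
  have "even m3" using assms(3) by (auto simp: m3_def m_index_def)
  then obtain a where a: "m3 = 2 * a" by auto
  have "even (m 1 + m 2)" using assms(3) by (simp add: m_index_def)
  then obtain b where "m 1 + m 2 = 2 * b" by (elim dvdE)
  hence b: "m 2 = 2 * b - m 1" by simp
  have "f 1 + f 2 = m 1 * (3 * m 1 + m 2 - m3) + m 2 * (m 2 - m 1 + m3)"
    unfolding f_def v by (simp add: algebra_simps)
  also have "\<dots> = 4 * (m 1 ^ 2 - m 1 * b + b ^ 2 + a * b - a * m 1)"
    unfolding a b by (simp add: algebra_simps power2_eq_square)
  finally have "4 dvd f 1 + f 2" by simp
  with 3 obtain c where "(\<Sum>j=1..dim2 n \<nu>. f j) = 4 * c" unfolding S by (metis dvd_add dvdE)
  hence "B2_form n \<nu> m / 2 = of_int c" by (simp add: B2_form_eq f_def)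
  thus ?thesis by simp
qed

lemma I1_row:
  "I1 n \<nu> i j = delta i (j + 1) + I1 n \<nu> i i * delta i j + I1 n \<nu> i (i + 1) * delta (i + 1) j"
  by (cases "i = j"; cases "i + 1 = j"; simp add: I1_def)

lemma I2_vec_ge_4:
  assumes "4 \<le> j" "j \<le> dim2 n \<nu>" "\<forall>k\<in>{1..dim2 n \<nu>}. 0 \<le> m k" "2 * m j \<le> I2_vec n \<nu> m j"
    "j < dim2 n \<nu> \<Longrightarrow> m (j + 1) \<le> m j"
  shows "m j \<le> m (j - 1)"
proof -
  define i where "i = j - 1"
  have i: "j = Suc i" "3 \<le> i" using assms(1) by (auto simp: i_def)
  define e where "e = I1 n \<nu> i i"
  define c where "c = I1 n \<nu> i (i + 1)"
  have I2: "I2 n \<nu> j k = delta i k + e * delta j k + c * delta (j + 1) k" if "1 \<le> k" for k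
  proof (cases "k = 1")
    case True
    thus ?thesis using i by (simp add: I2_def)
  next
    case False
    have k: "k = Suc (k - 1)" using that by simp
    have "I2 n \<nu> j k = I1 n \<nu> i (k - 1)" using i False by (simp add: I2_def)
    also have "\<dots> = delta i (k - 1 + 1) + e * delta i (k - 1) + c * delta (i + 1) (k - 1)"
      unfolding e_def c_def by (rule I1_row)
    also have "k - 1 + 1 = k" using that by simp
    also have "delta i (k - 1) = delta j k" using k i by auto
    also have "delta (i + 1) (k - 1) = delta (j + 1) k" using k i by auto
    finally show ?thesis .
  qed
  have "I2_vec n \<nu> m j = (\<Sum>k=1..dim2 n \<nu>. (if i = k then m k else 0)
      + (if j = k then e * m k else 0) + (if j + 1 = k then c * m k else 0))"
    unfolding I2_vec_def by (rule sum.cong) (simp_all add: I2 algebra_simps)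
  also have "\<dots> = m i + e * m j + (if j < dim2 n \<nu> then c * m (j + 1) else 0)"
    using i assms(2) by (simp add: sum.distrib)
  finally have v: "I2_vec n \<nu> m j
      = m (j - 1) + e * m j + (if j < dim2 n \<nu> then c * m (j + 1) else 0)"
    by (simp add: i_def)
  have nonneg: "0 \<le> m j" "j < dim2 n \<nu> \<Longrightarrow> 0 \<le> m (j + 1)" using assms(1-3) by auto
  have ec: "e = 0 \<or> e = 1" "j < dim2 n \<nu> \<Longrightarrow> e = 0 \<and> c = 1 \<or> e = 1 \<and> c = - 1"
    using i by (auto simp: e_def c_def I1_def dim2_def)
  show ?thesis
  proof (cases "j < dim2 n \<nu>")
    case True
    thus ?thesis using v nonneg ec(2) assms(4,5) by auto
  next
    case False
    thus ?thesis using v nonneg ec(1) assms(4) by auto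
  qed
qed

lemma q_binom_nonzeroD: "q_binom q n a \<noteq> 0 \<Longrightarrow> 0 \<le> a \<and> a \<le> n"
  by (simp add: q_binom_def split: if_splits)

lemma fermi_term_support:
  assumes "cfrac_expansion x n \<nu>" "x < 2" "fermi_term q n \<nu> L m \<noteq> 0" "j \<in> {1..dim2 n \<nu>}"
  shows "m j \<in> {0..L}"
proof -
  note n = cfrac_expansion_lt_2[OF assms(1,2)]
  have d: "2 \<le> dim2 n \<nu>" using dim1_ge(1)[of n \<nu>] n by (simp add: dim2_def)
  have nz: "q_binom q (L * delta j 1 + I2_vec n \<nu> m j div 2) (m j) \<noteq> 0"
    if "j \<in> {1..dim2 n \<nu>}" for j
    using assms(3) that by (auto simp: fermi_term_def)
  have nonneg: "\<forall>k\<in>{1..dim2 n \<nu>}. 0 \<le> m k"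
    using nz q_binom_nonzeroD by blast
  have ub: "2 * m j \<le> 2 * L * delta j 1 + I2_vec n \<nu> m j" if "j \<in> {1..dim2 n \<nu>}" for j
    using q_binom_nonzeroD[OF nz[OF that]] by auto
  define m3 where "m3 = (if 3 \<le> dim2 n \<nu> then m 3 else 0)"
  have m3: "0 \<le> m3" using nonneg by (auto simp: m3_def)
  have "3 * m 1 + m 2 - m3 \<le> 2 * L" "m 2 + m3 \<le> m 1"
    using ub[of 1] ub[of 2] d I2_vec_12[of n \<nu> m] n by (simp_all add: m3_def)
  moreover have "0 \<le> m 1" "0 \<le> m 2" using nonneg d by auto
  ultimately have m12: "m 1 \<le> L" "m 2 \<le> L" "m3 \<le> L" using m3 by linarith+
  have dec: "4 \<le> j \<Longrightarrow> m j \<le> m (j - 1)" if "j \<le> dim2 n \<nu>" for j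
    using that
  proof (induction j rule: inc_induct)
    case base
    show ?case using I2_vec_ge_4[of "dim2 n \<nu>" n \<nu> m] base nonneg ub[of "dim2 n \<nu>"] by auto
  next
    case (step j)
    show ?case using I2_vec_ge_4[of j n \<nu> m] step nonneg ub[of j] by auto
  qed
  have "j \<le> dim2 n \<nu> \<Longrightarrow> m j \<le> L" if "3 \<le> j" for j
    using that
  proof (induction j rule: dec_induct)
    case base
    thus ?case using m12 by (simp add: m3_def)
  next
    case (step j)
    thus ?case using dec[of "Suc j"] by auto
  qed
  hence "m j \<le> L" if "3 \<le> j" using assms(4) that by auto
  moreover have "j = 1 \<or> j = 2 \<or> 3 \<le> j" using assms(4) by auto
  ultimately show ?thesis using m12 nonneg assms(4) by auto
qed

lemma finite_fermi_support:
  assumes "cfrac_expansion x n \<nu>" "x < 2"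
  shows "finite {m \<in> m_index n \<nu>. fermi_term q n \<nu> L m \<noteq> 0}"
proof (rule finite_subset)
  show "{m \<in> m_index n \<nu>. fermi_term q n \<nu> L m \<noteq> 0} \<subseteq> {1..dim2 n \<nu>} \<rightarrow>\<^sub>E {0..L}"
  proof
    fix m assume m: "m \<in> {m \<in> m_index n \<nu>. fermi_term q n \<nu> L m \<noteq> 0}"
    hence "m \<in> extensional {1..dim2 n \<nu>}" by (simp add: m_index_def PiE_def)
    moreover have "m \<in> {1..dim2 n \<nu>} \<rightarrow> {0..L}"
      using m fermi_term_support[OF assms] by blast
    ultimately show "m \<in> {1..dim2 n \<nu>} \<rightarrow>\<^sub>E {0..L}" by (simp add: PiE_def)
  qed
  show "finite ({1..dim2 n \<nu>} \<rightarrow>\<^sub>E {0..L})" by (rule finite_PiE) simp_all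
qed

lemma q_trinom2_eq_0: "L < \<bar>a\<bar> \<Longrightarrow> q_trinom2 q L b a = 0"
proof -
  assume a: "L < \<bar>a\<bar>"
  have "q_binom q (L - k) (k + a) = 0" if "k \<in> {0..L}" for k
    using q_binom_nonzeroD[of q "L - k" "k + a"] that a by fastforce
  thus ?thesis by (simp add: q_trinom2_def)
qed

lemma finite_bose_support:
  assumes "0 < p'"
  shows "finite {j. bose_term q p p' r s L j \<noteq> 0}"
proof (rule finite_subset)
  show "{j. bose_term q p p' r s L j \<noteq> 0} \<subseteq> {- \<bar>L\<bar> - 2 * \<bar>s\<bar>..\<bar>L\<bar> + 2 * \<bar>s\<bar>}"
  proof
    fix j assume "j \<in> {j. bose_term q p p' r s L j \<noteq> 0}"
    hence "\<bar>2 * p' * j\<bar> \<le> L \<or> \<bar>2 * p' * j + 2 * s\<bar> \<le> L"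
      using q_trinom2_eq_0[of L _ q] by (fastforce simp: bose_term_def not_less[symmetric])
    hence "\<bar>2 * p' * j\<bar> \<le> \<bar>L\<bar> + 2 * \<bar>s\<bar>" by linarith
    moreover have "\<bar>2 * p' * j\<bar> = 2 * p' * \<bar>j\<bar>" using assms by (simp add: abs_mult)
    moreover have "1 * \<bar>j\<bar> \<le> 2 * p' * \<bar>j\<bar>" using assms by (intro mult_right_mono) auto
    ultimately show "j \<in> {- \<bar>L\<bar> - 2 * \<bar>s\<bar>..\<bar>L\<bar> + 2 * \<bar>s\<bar>}" by auto
  qed
qed simp

end

theory Submission
  imports Defs
begin

text \<open>Write \<open>B(L,M,a,b)\<close> for the product of the two \<open>q\<close>-binomials
  \<open>[L+M+a-b; L+a]\<close> and \<open>[L+M-a+b; L-a]\<close>. The \<open>q\<close>-Saalschuetz sum gives the Burge transform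
  \<open>(a,b) \<mapsto> (a+b,b)\<close> on these functions, and \<open>B(L,M,a,b) = B(M,L,b,a)\<close>. Combined, the two run the
  Euclidean algorithm backwards: starting from the pair \<open>(2,1)\<close>, where the alternating bosonic sum
  telescopes to \<open>\<delta>\<^bsub>L,0\<^esub>\<close>, one reaches the bosonic sum of every pair \<open>(p',p)\<close>, and each step adds one
  summation to the fermionic side. A Vandermonde sum removes the bound \<open>M\<close> in the last step.
  Expanding the \<open>q\<close>-trinomials in \<open>q\<close>-binomials \<open>[L; 2a] [2a; a-b]\<close> reduces the
  right-hand side of the theorem to these sums, and on the left-hand side the sum over \<open>m\<^sub>1\<close> with
  \<open>m\<^sub>1 + m\<^sub>2 = 2a\<close> fixed is a Vandermonde sum with value \<open>[L; 2a]\<close>.\<close>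

section \<open>Sums of q-binomial coefficients\<close>

lemma mult_sum_eqI:
  fixes c :: "'a::comm_semiring_1"
  shows "(\<Sum>i\<in>A. f i * g i) = x \<Longrightarrow> c * x = (\<Sum>i\<in>A. f i * (c * g i))"
  by (auto simp: sum_distrib_left mult.left_commute)

text \<open>For \<open>j \<ge> 0\<close> both factors are nonnegative; for \<open>j \<le> -1\<close>
  the bounds \<open>u \<le> x\<close> and \<open>v \<le> y\<close> make both nonpositive. This
  supplies the sign condition of the Burge transform for every summand of a bosonic sum.\<close>

lemma affine_mult_nonneg:
  fixes u v x y j :: int
  assumes "0 \<le> u" "u \<le> x" "0 \<le> v" "v \<le> y"
  shows "0 \<le> (x * j + u) * (y * j + v)"
proof (cases "0 \<le> j")
  case True
  thus ?thesis using assms by simp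
next
  case False
  have "x * j + u \<le> 0"
  proof -
    have "x * j \<le> x * (- 1)" using False assms by (intro mult_left_mono) auto
    thus ?thesis using assms by simp
  qed
  moreover have "y * j + v \<le> 0"
  proof -
    have "y * j \<le> y * (- 1)" using False assms by (intro mult_left_mono) auto
    thus ?thesis using assms by simp
  qed
  ultimately show ?thesis by (simp add: zero_le_mult_iff)
qed

text \<open>\<open>q_power_neq_1\<close> keeps every \<open>q_fact q n\<close> invertible, and
  \<open>q_nonzero\<close> lets exponents add under \<open>powi\<close>. An indeterminate satisfies
  both.\<close>

locale generic_q =
  fixes q :: "'a::field"
  assumes q_nonzero: "q \<noteq> 0"
    and q_power_neq_1: "0 < n \<Longrightarrow> q ^ n \<noteq> 1"
begin

lemma q_fact_Suc: "q_fact q (Suc n) = q_fact q n * (1 - q ^ Suc n)"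
  by (simp add: q_fact_def)

lemma q_fact_nonzero: "q_fact q n \<noteq> 0"
  using q_power_neq_1 by (auto simp: q_fact_def)

lemma q_binom_eq_0: "a < 0 \<or> n < a \<Longrightarrow> q_binom q n a = 0"
  by (auto simp: q_binom_def)

lemma q_binom_0_right: "0 \<le> n \<Longrightarrow> q_binom q n 0 = 1"
  using q_fact_nonzero by (simp add: q_binom_def q_fact_def)

lemma q_binom_self: "0 \<le> n \<Longrightarrow> q_binom q n n = 1"
  using q_fact_nonzero by (simp add: q_binom_def q_fact_def)

lemma q_binom_sym: "q_binom q n (n - a) = q_binom q n a"
  by (auto simp: q_binom_def mult.commute)

text \<open>The rule fails only at \<open>n = a = 0\<close>, where the left side is 1 and the right
  side 0; negative \<open>n\<close> is allowed.\<close>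

lemma q_binom_pascal:
  assumes "n \<noteq> 0 \<or> a \<noteq> 0"
  shows "q_binom q n a = q_binom q (n - 1) (a - 1) + q powi a * q_binom q (n - 1) a"
proof -
  consider "a < 0" | "a > n" | "a = 0" "0 < n" | "a = n" "0 < n" | "0 < a" "a < n"
    using assms by linarith
  thus ?thesis
  proof cases
    case 3
    thus ?thesis by (simp add: q_binom_0_right q_binom_eq_0)
  next
    case 4
    thus ?thesis by (simp add: q_binom_self q_binom_eq_0)
  next
    case 5
    define x where "x = nat (a - 1)"
    define y where "y = nat (n - a - 1)"
    have a: "a = int (Suc x)" and n: "n = int (Suc x + Suc y)" using 5 by (auto simp: x_def y_def)
    have *: "nat n = Suc (Suc (x + y))" "nat a = Suc x" "nat (n - a) = Suc y" "nat (n - 1) = Suc (x + y)"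
      "nat (a - 1) = x" "nat (n - 1 - (a - 1)) = Suc y" "nat (n - 1 - a) = y"
      using a n by auto
    have nz: "1 - q ^ Suc x \<noteq> 0" "1 - q ^ Suc y \<noteq> 0"
      using q_power_neq_1[of "Suc x"] q_power_neq_1[of "Suc y"] by auto
    have pw: "q powi a = q ^ Suc x" unfolding a by (rule power_int_of_nat)
    have "1 - q ^ Suc (Suc (x + y)) = (1 - q ^ Suc x) + q ^ Suc x * (1 - q ^ Suc y)"
      by (simp add: algebra_simps power_add)
    hence "q_fact q (Suc (Suc (x + y))) = q_fact q (Suc (x + y)) * ((1 - q ^ Suc x) + q ^ Suc x *
        (1 - q ^ Suc y))"
      by (simp only: q_fact_Suc[of "Suc (x + y)"])
    moreover have "q_binom q n a = q_fact q (Suc (Suc (x + y))) / (q_fact q (Suc x) * q_fact q (Suc y))"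
      "q_binom q (n - 1) (a - 1) = q_fact q (Suc (x + y)) / (q_fact q x * q_fact q (Suc y))"
      "q_binom q (n - 1) a = q_fact q (Suc (x + y)) / (q_fact q (Suc x) * q_fact q y)"
      using 5 unfolding q_binom_def * by simp_all
    moreover have "F * (u + z * v) / (f * u * (g * v)) = F / (f * (g * v)) + z * (F / (f * u * g))"
      if "u \<noteq> 0" "v \<noteq> 0" "f \<noteq> 0" "g \<noteq> 0" for F f g u v z :: 'a
      using that by (simp add: field_simps)
    ultimately show ?thesis
      unfolding pw q_fact_Suc[of x] q_fact_Suc[of y] using nz q_fact_nonzero by simp
  qed (auto simp: q_binom_eq_0)
qed

lemma q_binom_pascal':
  assumes "n \<noteq> 0 \<or> a \<noteq> 0"
  shows "q_binom q n a = q_binom q (n - 1) a + q powi (n - a) * q_binom q (n - 1) (a - 1)"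
proof -
  have "q_binom q n (n - a) = q_binom q (n - 1) (n - 1 - a) + q powi (n - a) *
      q_binom q (n - 1) (n - 1 - (a - 1))"
    using q_binom_pascal[of n "n - a"] assms by (simp add: algebra_simps)
  thus ?thesis by (simp only: q_binom_sym)
qed

text \<open>In the nonvanishing range both sides are the q-multinomial
  \<open>(q)_n / ((q)_a (q)_b (q)_(n-a-b))\<close>.\<close>

lemma q_binom_mult_q_binom:
  "q_binom q n a * q_binom q (n - a) b = q_binom q n (a + b) * q_binom q (a + b) a"
proof (cases "0 \<le> a \<and> 0 \<le> b \<and> a + b \<le> n")
  case True
  thus ?thesis using q_fact_nonzero by (simp add: q_binom_def algebra_simps)
next
  case False
  thus ?thesis by (auto simp: q_binom_def)
qed

text \<open>Moving one unit from \<open>n\<close> to \<open>m\<close> with both Pascal rules leaves two sums which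
  become termwise comparable after shifting the second one by one.\<close>

lemma q_binom_shift_sum:
  assumes "0 \<le> m" "1 \<le> n"
  shows "(\<Sum>k=0..m. q powi (k * (k + A)) * q_binom q m k * q_binom q n (k + A) * f k)
       = (\<Sum>k=0..m + 1. q powi (k * (k + (A - 1))) * q_binom q (m + 1) k * q_binom q (n - 1) (k + (A - 1)) * f k)
       + (\<Sum>k=0..m. q powi (k * (k + A) + k + A) * q_binom q m k * q_binom q (n - 1) (k + A) * (f k - f (k +
           1)))"
proof -
  \<comment> \<open>\<open>g\<close> is common to both expansions. Pascal at \<open>n\<close> leaves
    the extra term \<open>h k\<close> on the left, Pascal at \<open>m + 1\<close> leaves
    \<open>h (k - 1)\<close> on the right.\<close>
  define g where "g k = q powi (k * (k + A)) * q_binom q m k * q_binom q (n - 1) (k + (A - 1)) * f k" for k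
  define h where "h k = q powi (k * (k + A) + k + A) * q_binom q m k * q_binom q (n - 1) (k + A)" for k
  have 1: "q powi (k * (k + A)) * q_binom q m k * q_binom q n (k + A) * f k = g k + h k * f k" for k
  proof -
    have "q_binom q n (k + A) = q_binom q (n - 1) (k + (A - 1)) + q powi (k + A) * q_binom q (n - 1) (k + A)"
      using q_binom_pascal[of n "k + A"] assms by (simp add: algebra_simps)
    thus ?thesis using q_nonzero
      by (simp add: g_def h_def algebra_simps power_int_add)
  qed
  have 2: "q powi (k * (k + (A - 1))) * q_binom q (m + 1) k * q_binom q (n - 1) (k + (A - 1)) * f k
      = g k + h (k - 1) * f k" for k
  proof -
    have "q_binom q (m + 1) k = q_binom q m (k - 1) + q powi k * q_binom q m k"
      using q_binom_pascal[of "m + 1" k] assms by simp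
    moreover have "q powi (k * (k + A)) = q powi (k * (k + (A - 1))) * q powi k"
      using q_nonzero by (simp add: power_int_add[symmetric] algebra_simps)
    moreover have "(k - 1) * (k - 1 + A) + (k - 1) + A = k * (k + (A - 1))" by (simp add: algebra_simps)
    ultimately show ?thesis by (simp add: g_def h_def algebra_simps)
  qed
  have "(\<Sum>k=0..m + 1. g k + h (k - 1) * f k) = (\<Sum>k=0..m + 1. g k) + (\<Sum>k=0..m + 1. h (k - 1) * f k)"
    by (rule sum.distrib)
  also have "(\<Sum>k=0..m + 1. g k) = (\<Sum>k=0..m. g k)"
    by (rule sum.mono_neutral_right) (auto simp: g_def q_binom_eq_0)
  also have "(\<Sum>k=0..m + 1. h (k - 1) * f k) = (\<Sum>k=1..m + 1. h (k - 1) * f k)"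
    by (rule sum.mono_neutral_right) (auto simp: h_def q_binom_eq_0)
  also have "\<dots> = (\<Sum>k=0..m. h k * f (k + 1))"
    by (rule sum.reindex_bij_witness[of _ "\<lambda>k. k + 1" "\<lambda>k. k - 1"]) auto
  finally have 3: "(\<Sum>k=0..m + 1. g k + h (k - 1) * f k) = (\<Sum>k=0..m. g k) + (\<Sum>k=0..m. h k * f (k + 1))" .
  have "(\<Sum>k=0..m. g k + h k * f k) =
      ((\<Sum>k=0..m. g k) + (\<Sum>k=0..m. h k * f (k + 1))) + (\<Sum>k=0..m. h k * (f k - f (k + 1)))"
    by (simp add: sum.distrib[symmetric] algebra_simps)
  thus ?thesis unfolding 1 2 h_def[symmetric] 3 by simp
qed

text \<open>With constant weight the difference term of \<open>q_binom_shift_sum\<close> vanishes,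
  so \<open>(m, n + 1, A)\<close> reduces to \<open>(m + 1, n, A - 1)\<close>, which has the same
  right-hand side. At \<open>n = 0\<close> only \<open>k = - A\<close> survives.\<close>

lemma q_vandermonde:
  assumes "0 \<le> m" "0 \<le> n"
  shows "(\<Sum>k=0..m. q powi (k * (k + A)) * q_binom q m k * q_binom q n (k + A)) = q_binom q (m + n) (m + A)"
  using assms(2,1)
proof (induction n arbitrary: m A rule: int_ge_induct)
  case base
  have "q_binom q 0 (k + A) = of_bool (k = - A)" for k
    using q_binom_0_right[of 0] by (auto simp: q_binom_eq_0 linorder_neq_iff)
  hence "(\<Sum>k=0..m. q powi (k * (k + A)) * q_binom q m k * q_binom q 0 (k + A)) =
      (\<Sum>k=0..m. if k = - A then q_binom q m k else 0)"
    by (intro sum.cong) auto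
  also have "\<dots> = q_binom q m (- A)" by (auto simp: q_binom_eq_0)
  finally show ?case using q_binom_sym[of m "- A"] by simp
next
  case (step n)
  thus ?case using q_binom_shift_sum[of m "n + 1" A "\<lambda>_. 1"] step.IH[of "m + 1" "A - 1"]
    by (simp add: algebra_simps)
qed

text \<open>Here the difference of consecutive weights is again a weight of the same shape, one size
  smaller. The induction hypothesis is therefore used twice, at \<open>(m + 1, A - 1)\<close> and at
  \<open>(m, A)\<close>, and Pascal joins the two values.\<close>

lemma q_saalschuetz:
  assumes "0 \<le> m" "0 \<le> n"
  shows "(\<Sum>k=0..m. q powi (k * (k + A)) * q_binom q m k * q_binom q n (k + A) * q_binom q (m + n + R - k) (m
      + n))
       = q_binom q (m + A + R) R * q_binom q (n + R) (R + A)"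
  using assms(2,1)
proof (induction n arbitrary: m A rule: int_ge_induct)
  case base
  have "q_binom q 0 (k + A) = of_bool (k = - A)" for k
    using q_binom_0_right[of 0] by (auto simp: q_binom_eq_0 linorder_neq_iff)
  hence "(\<Sum>k=0..m. q powi (k * (k + A)) * q_binom q m k * q_binom q 0 (k + A) * q_binom q (m + 0 + R - k) (m
      + 0)) =
      (\<Sum>k=0..m. if k = - A then q_binom q m k * q_binom q (m + R - k) m else 0)"
    by (intro sum.cong) auto
  also have "\<dots> = q_binom q m (- A) * q_binom q (m + R + A) m" by (auto simp: q_binom_eq_0)
  also have "\<dots> = q_binom q (m + A + R) R * q_binom q R (R + A)"
  proof (cases "0 \<le> - A \<and> - A \<le> m \<and> - A \<le> R")
    case True
    thus ?thesis using q_fact_nonzero by (simp add: q_binom_def algebra_simps)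
  next
    case False
    thus ?thesis using base by (auto simp: q_binom_def)
  qed
  finally show ?case by simp
next
  case (step n)
  define N where "N = m + (n + 1)"
  have d: "q_binom q (N + R - k) N - q_binom q (N + R - (k + 1)) N
      = q powi (R - k) * q_binom q (m + n + R - k) (m + n)" for k
    using q_binom_pascal'[of "N + R - k" N] step by (simp add: N_def algebra_simps)
  have e: "q powi (k * (k + A) + k + A) * u * v * (q powi (R - k) * w) = q powi (R + A) * (q powi (k * (k +
      A)) * u * v * w)"
    for k u v w
  proof -
    have "q powi (k * (k + A) + k + A) * q powi (R - k) = q powi (R + A) * q powi (k * (k + A))"
      using q_nonzero by (simp add: power_int_add[symmetric] algebra_simps)
    thus ?thesis by (simp add: algebra_simps)
  qed
  have "(\<Sum>k=0..m. q powi (k * (k + A)) * q_binom q m k * q_binom q (n + 1) (k + A) * q_binom q (N + R - k) N)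
      = q_binom q (m + A + R) R * q_binom q (n + R) (R + A - 1)
        + q powi (R + A) * (q_binom q (m + A + R) R * q_binom q (n + R) (R + A))"
    using q_binom_shift_sum[of m "n + 1" A "\<lambda>k. q_binom q (N + R - k) N"] step.IH[of "m + 1" "A - 1"]
      step.IH[of m A] step.prems step.hyps
    unfolding d e sum_distrib_left[symmetric] by (simp add: N_def algebra_simps)
  also have "\<dots> = q_binom q (m + A + R) R * q_binom q (n + 1 + R) (R + A)"
  \<comment> \<open>For \<open>R < 0\<close> the factor with lower entry \<open>R\<close> is zero;
    otherwise \<open>n + 1 + R\<close> is positive and Pascal applies.\<close>
  proof (cases "R < 0")
    case False
    thus ?thesis using q_binom_pascal[of "n + 1 + R" "R + A"] step by (simp add: algebra_simps)
  qed (simp add: q_binom_eq_0)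
  finally show ?case by (simp add: N_def)
qed

section \<open>The Burge transform\<close>

definition burge_B :: "int \<Rightarrow> int \<Rightarrow> int \<Rightarrow> int \<Rightarrow> 'a" where
  "burge_B L M a b = q_binom q (L + M + a - b) (L + a) * q_binom q (L + M - a + b) (L - a)"

lemma burge_B_sym: "burge_B L M a b = burge_B M L b a"
proof -
  have "burge_B M L b a = q_binom q (L + M - a + b) (L + M - a + b - (L - a)) *
      q_binom q (L + M + a - b) (L + M + a - b - (L + a))"
    by (simp add: burge_B_def algebra_simps)
  thus ?thesis unfolding q_binom_sym by (simp add: burge_B_def)
qed

text \<open>After reflection the two factors are \<open>[m; i-b]\<close> and
  \<open>[n; i+b]\<close>, and \<open>i = k + b\<close> gives the Vandermonde shape with
  \<open>A = 2 * b\<close>. The weight \<open>f\<close> stays free so that both the bounded and the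
  unbounded transform can use it.\<close>

lemma burge_B_sum:
  assumes "\<bar>a - b\<bar> \<le> L"
  shows "(\<Sum>i=0..L. q powi (i * i) * f i * burge_B (L - i) i a b)
       = q powi (b * b) * (\<Sum>k=0..L + a - b. q powi (k * (k + 2 * b)) * q_binom q (L + a - b) k *
           q_binom q (L - a + b) (k + 2 * b) * f (k + b))"
proof -
  define m n where "m = L + a - b" and "n = L - a + b"
  have B: "burge_B (L - i) i a b = q_binom q m (i - b) * q_binom q n (i + b)" for i
  proof -
    have "burge_B (L - i) i a b = q_binom q m (m - (i - b)) * q_binom q n (n - (i + b))"
      by (simp add: burge_B_def m_def n_def algebra_simps)
    thus ?thesis unfolding q_binom_sym .
  qed
  \<comment> \<open>Nonzero binomials force \<open>0 \<le> 2 * i\<close> and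
    \<open>2 * i \<le> m + n = 2 * L\<close>, so the two ranges differ only by zero terms.\<close>
  have "(\<Sum>i=0..L. q powi (i * i) * f i * burge_B (L - i) i a b)
      = (\<Sum>i=b..m + b. q powi (i * i) * f i * burge_B (L - i) i a b)"
    by (rule sum.mono_neutral_cong) (auto simp: B q_binom_def m_def n_def)
  also have "\<dots> = (\<Sum>k=0..m. q powi (b * b) * (q powi (k * (k + 2 * b)) * q_binom q m k *
      q_binom q n (k + 2 * b) * f (k + b)))"
  proof (rule sum.reindex_bij_witness[of _ "\<lambda>k. k + b" "\<lambda>k. k - b"])
    fix i assume "i \<in> {b..m + b}"
    have "q powi (i * i) = q powi (b * b) * q powi ((i - b) * (i - b + 2 * b))"
      using q_nonzero by (simp add: power_int_add[symmetric] algebra_simps)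
    moreover have "i - b + 2 * b = i + b" by simp
    ultimately show "q powi (b * b) * (q powi ((i - b) * (i - b + 2 * b)) * q_binom q m (i - b) *
        q_binom q n (i - b + 2 * b) * f (i - b + b)) = q powi (i * i) * f i * burge_B (L - i) i a b"
      unfolding B by (simp add: algebra_simps)
  qed auto
  finally show ?thesis by (simp add: sum_distrib_left m_def n_def)
qed

text \<open>In both transforms the sign condition is needed: the left-hand side vanishes for
  \<open>L < \<bar>a - b\<bar>\<close>, while the right-hand side need not vanish for \<open>L \<ge> \<bar>a + b\<bar>\<close>.\<close>

lemma burge_transform:
  assumes "0 \<le> a * b"
  shows "(\<Sum>i=0..L. q powi (i * i) * q_binom q (2 * L + M - i) (2 * L) * burge_B (L - i) i a b)
       = q powi (b * b) * burge_B L M (a + b) b"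
proof (cases "\<bar>a - b\<bar> \<le> L")
  case False
  have "\<bar>a - b\<bar> \<le> \<bar>a + b\<bar>" using assms by (auto simp: zero_le_mult_iff)
  hence "L - (a + b) < 0 \<or> L + (a + b) < 0" using False by linarith
  hence "burge_B L M (a + b) b = 0" by (auto simp: burge_B_def q_binom_eq_0)
  moreover have "burge_B (L - i) i a b = 0" for i
    using False by (auto simp: burge_B_def q_binom_def)
  ultimately show ?thesis by simp
next
  case True
  hence mn: "0 \<le> L + a - b" "0 \<le> L - a + b" by auto
  \<comment> \<open>Saalschuetz with \<open>A = 2 * b\<close> and \<open>R = M - b\<close>; the two
    upper entries add up to \<open>2 * L\<close>.\<close>
  have "(\<Sum>k=0..L + a - b. q powi (k * (k + 2 * b)) * q_binom q (L + a - b) k *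
      q_binom q (L - a + b) (k + 2 * b) * q_binom q (2 * L + M - (k + b)) (2 * L))
    = q_binom q (L + a - b + 2 * b + (M - b)) (M - b) * q_binom q (L - a + b + (M - b)) (M - b + 2 * b)"
    using q_saalschuetz[OF mn, of "2 * b" "M - b"] by (simp add: algebra_simps)
  also have "\<dots> = burge_B M L b (a + b)"
    by (simp add: burge_B_def algebra_simps)
  finally show ?thesis
    unfolding burge_B_sum[OF True] by (simp add: burge_B_sym[of M])
qed

lemma burge_transform_limit:
  assumes "0 \<le> a * b"
  shows "(\<Sum>i=0..L. q powi (i * i) * burge_B (L - i) i a b) = q powi (b * b) * q_binom q (2 * L) (L - (a + b))"
proof (cases "\<bar>a - b\<bar> \<le> L")
  case False
  have "\<bar>a - b\<bar> \<le> \<bar>a + b\<bar>" using assms by (auto simp: zero_le_mult_iff)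
  hence "q_binom q (2 * L) (L - (a + b)) = 0" using False by (auto simp: q_binom_def)
  moreover have "burge_B (L - i) i a b = 0" for i
    using False by (auto simp: burge_B_def q_binom_def)
  ultimately show ?thesis by simp
next
  case True
  hence mn: "0 \<le> L + a - b" "0 \<le> L - a + b" by auto
  have "(\<Sum>k=0..L + a - b. q powi (k * (k + 2 * b)) * q_binom q (L + a - b) k *
      q_binom q (L - a + b) (k + 2 * b)) = q_binom q (2 * L) (L + (a + b))"
    using q_vandermonde[OF mn, of "2 * b"] by (simp add: algebra_simps)
  also have "\<dots> = q_binom q (2 * L) (L - (a + b))"
    using q_binom_sym[of "2 * L" "L + (a + b)"] by (simp add: algebra_simps)
  finally show ?thesis
    using burge_B_sum[OF True, of "\<lambda>_. 1"] by simp
qed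

section \<open>Bosonic sums under the Burge transform\<close>

definition boson :: "int set \<Rightarrow> int \<times> int \<Rightarrow> int \<times> int \<Rightarrow> int \<Rightarrow> int \<Rightarrow> 'a" where
  "boson J = (\<lambda>(p', p) (s, r) L M. \<Sum>j\<in>J.
     q powi (j * (p * p' * j + 1)) * burge_B L M (p' * j) (p * j)
     - q powi ((p' * j + s) * (p * j + r)) * burge_B L M (p' * j + s) (p * j + r))"

text \<open>The transform acts on each \<open>j\<close> separately, so \<open>J\<close> is
  arbitrary. Its factor \<open>q powi (b * b)\<close> turns the exponent for \<open>p * p'\<close>
  into the one for \<open>p * (p' + p)\<close>, and likewise in the second family.\<close>

lemma boson_normal_step:
  assumes "0 \<le> s" "s \<le> p'" "0 \<le> r" "r \<le> p"
  shows "boson J (p' + p, p) (s + r, r) L M =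
    (\<Sum>i=0..L. q powi (i * i) * q_binom q (2 * L + M - i) (2 * L) * boson J (p', p) (s, r) (L - i) i)"
proof -
  have 1: "q powi (j * (p * (p' + p) * j + 1)) * burge_B L M ((p' + p) * j) (p * j) =
      (\<Sum>i=0..L. q powi (i * i) * q_binom q (2 * L + M - i) (2 * L) *
        (q powi (j * (p * p' * j + 1)) * burge_B (L - i) i (p' * j) (p * j)))" for j
  proof -
    have "0 \<le> (p' * j) * (p * j)" using affine_mult_nonneg[of 0 p' 0 p j] assms by simp
    from burge_transform[OF this, of L M]
    have "q powi (j * (p * p' * j + 1)) * (q powi (p * j * (p * j)) * burge_B L M (p' * j + p * j) (p * j)) =
      (\<Sum>i=0..L. q powi (i * i) * q_binom q (2 * L + M - i) (2 * L) *
        (q powi (j * (p * p' * j + 1)) * burge_B (L - i) i (p' * j) (p * j)))"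
      by (rule mult_sum_eqI)
    moreover have "q powi (j * (p * (p' + p) * j + 1)) = q powi (j * (p * p' * j + 1)) * q powi (p * j * (p
        * j))"
      using q_nonzero by (simp add: power_int_add[symmetric] algebra_simps)
    moreover have "(p' + p) * j = p' * j + p * j" by (simp add: algebra_simps)
    ultimately show ?thesis by (simp add: mult.assoc)
  qed
  have 2: "q powi (((p' + p) * j + (s + r)) * (p * j + r)) * burge_B L M ((p' + p) * j + (s + r)) (p * j + r) =
      (\<Sum>i=0..L. q powi (i * i) * q_binom q (2 * L + M - i) (2 * L) *
        (q powi ((p' * j + s) * (p * j + r)) * burge_B (L - i) i (p' * j + s) (p * j + r)))" for j
  proof -
    have "0 \<le> (p' * j + s) * (p * j + r)" using affine_mult_nonneg[of s p' r p j] assms by simp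
    from burge_transform[OF this, of L M]
    have "q powi ((p' * j + s) * (p * j + r)) * (q powi ((p * j + r) * (p * j + r)) * burge_B L M (p' * j +
        s + (p * j + r)) (p * j + r)) =
      (\<Sum>i=0..L. q powi (i * i) * q_binom q (2 * L + M - i) (2 * L) *
        (q powi ((p' * j + s) * (p * j + r)) * burge_B (L - i) i (p' * j + s) (p * j + r)))"
      by (rule mult_sum_eqI)
    moreover have "q powi (((p' + p) * j + (s + r)) * (p * j + r)) =
        q powi ((p' * j + s) * (p * j + r)) * q powi ((p * j + r) * (p * j + r))"
      using q_nonzero by (simp add: power_int_add[symmetric] algebra_simps)
    moreover have e: "(p' + p) * j + (s + r) = p' * j + s + (p * j + r)" by (simp add: algebra_simps)
    ultimately show ?thesis unfolding e by (simp add: mult.assoc)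
  qed
  have "boson J (p' + p, p) (s + r, r) L M =
    (\<Sum>j\<in>J. \<Sum>i=0..L. q powi (i * i) * q_binom q (2 * L + M - i) (2 * L) *
      (q powi (j * (p * p' * j + 1)) * burge_B (L - i) i (p' * j) (p * j)
       - q powi ((p' * j + s) * (p * j + r)) * burge_B (L - i) i (p' * j + s) (p * j + r)))"
    unfolding boson_def prod.case 1 2 by (simp only: sum_subtractf right_diff_distrib)
  also have "\<dots> = (\<Sum>i=0..L. q powi (i * i) * q_binom q (2 * L + M - i) (2 * L) * boson J (p', p) (s,
      r) (L - i) i)"
    unfolding boson_def prod.case sum_distrib_left by (rule sum.swap)
  finally show ?thesis .
qed

lemma boson_swap: "boson J (p', p) (s, r) L M = boson J (p, p') (r, s) M L"
  unfolding boson_def prod.case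
  by (intro sum.cong refl) (simp add: burge_B_sym[of L] mult_ac)

text \<open>A normal step conjugated by \<open>boson_swap\<close>, which is why the inner arguments
  appear in the order \<open>i\<close>, \<open>L - i\<close>.\<close>

lemma boson_turn_step:
  assumes "0 \<le> s" "s \<le> p'" "0 \<le> r" "r \<le> p"
  shows "boson J (p' + p, p') (s + r, s) L M =
    (\<Sum>i=0..L. q powi (i * i) * q_binom q (2 * L + M - i) (2 * L) * boson J (p', p) (s, r) i (L - i))"
proof -
  have "boson J (p + p', p') (r + s, s) L M =
    (\<Sum>i=0..L. q powi (i * i) * q_binom q (2 * L + M - i) (2 * L) * boson J (p, p') (r, s) (L - i) i)"
    using assms by (rule boson_normal_step[rotated 2])
  thus ?thesis unfolding boson_swap[of J p p'] by (simp add: add.commute)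
qed

text \<open>The turn step with \<open>M\<close> removed. Its binomials \<open>[2L; L-x]\<close> are
  those that occur when q-trinomials are expanded.\<close>

lemma boson_turn_limit:
  assumes "0 \<le> s" "s \<le> p'" "0 \<le> r" "r \<le> p"
  shows "(\<Sum>i=0..L. q powi (i * i) * boson J (p', p) (s, r) i (L - i)) =
    (\<Sum>j\<in>J. q powi (j * (p' * (p' + p) * j + 1)) * q_binom q (2 * L) (L - (p' + p) * j)
       - q powi (((p' + p) * j + (s + r)) * (p' * j + s)) * q_binom q (2 * L) (L - ((p' + p) * j + (s + r))))"
proof -
  have 1: "q powi (j * (p' * (p' + p) * j + 1)) * q_binom q (2 * L) (L - (p' + p) * j) =
      (\<Sum>i=0..L. q powi (i * i) * (q powi (j * (p * p' * j + 1)) * burge_B i (L - i) (p' * j) (p * j)))" for j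
  proof -
    have "0 \<le> (p * j) * (p' * j)" using affine_mult_nonneg[of 0 p 0 p' j] assms by simp
    from burge_transform_limit[OF this, of L]
    have "q powi (j * (p * p' * j + 1)) * (q powi (p' * j * (p' * j)) * q_binom q (2 * L) (L - (p * j + p' *
        j))) =
      (\<Sum>i=0..L. q powi (i * i) * (q powi (j * (p * p' * j + 1)) * burge_B (L - i) i (p * j) (p' * j)))"
      by (rule mult_sum_eqI)
    moreover have "q powi (j * (p' * (p' + p) * j + 1)) = q powi (j * (p * p' * j + 1)) * q powi (p' * j *
        (p' * j))"
      using q_nonzero by (simp add: power_int_add[symmetric] algebra_simps)
    moreover have "(p' + p) * j = p * j + p' * j" by (simp add: algebra_simps)
    ultimately show ?thesis by (simp add: burge_B_sym[of "L - _"] mult.assoc)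
  qed
  have 2: "q powi (((p' + p) * j + (s + r)) * (p' * j + s)) * q_binom q (2 * L) (L - ((p' + p) * j + (s + r))) =
      (\<Sum>i=0..L. q powi (i * i) * (q powi ((p' * j + s) * (p * j + r)) * burge_B i (L - i) (p' * j + s) (p *
          j + r)))" for j
  proof -
    have "0 \<le> (p * j + r) * (p' * j + s)" using affine_mult_nonneg[of r p s p' j] assms by simp
    from burge_transform_limit[OF this, of L]
    have "q powi ((p' * j + s) * (p * j + r)) * (q powi ((p' * j + s) * (p' * j + s)) * q_binom q (2 *
        L) (L - (p * j + r + (p' * j + s)))) =
      (\<Sum>i=0..L. q powi (i * i) * (q powi ((p' * j + s) * (p * j + r)) * burge_B (L - i) i (p * j + r) (p' *
          j + s)))"
      by (rule mult_sum_eqI)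
    moreover have "q powi (((p' + p) * j + (s + r)) * (p' * j + s)) =
        q powi ((p' * j + s) * (p * j + r)) * q powi ((p' * j + s) * (p' * j + s))"
      using q_nonzero by (simp add: power_int_add[symmetric] algebra_simps)
    moreover have e: "(p' + p) * j + (s + r) = p * j + r + (p' * j + s)" by (simp add: algebra_simps)
    ultimately show ?thesis unfolding e by (simp add: burge_B_sym[of "L - _"] mult.assoc)
  qed
  have "(\<Sum>i=0..L. q powi (i * i) * boson J (p', p) (s, r) i (L - i)) =
    (\<Sum>j\<in>J. \<Sum>i=0..L. q powi (i * i) *
      (q powi (j * (p * p' * j + 1)) * burge_B i (L - i) (p' * j) (p * j)
       - q powi ((p' * j + s) * (p * j + r)) * burge_B i (L - i) (p' * j + s) (p * j + r)))"
    unfolding boson_def prod.case sum_distrib_left by (rule sum.swap)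
  thus ?thesis
    unfolding 1 2 by (simp only: sum_subtractf right_diff_distrib)
qed

text \<open>Outside \<open>L = M = 0\<close> the sum telescopes, and \<open>K\<close> is large
  enough for both boundary terms to vanish.\<close>

lemma boson_1_1:
  assumes "0 \<le> L" "0 \<le> M" "L < K" "M < K"
  shows "boson {-K..K} (1, 1) (1, 0) L M = of_bool (L = 0 \<and> M = 0)"
proof (cases "L + M = 0")
  case True
  hence LM: "L = 0" "M = 0" using assms by auto
  have "boson {-K..K} (1, 1) (1, 0) L M = (\<Sum>j=-K..K. if j = 0 then 1 else 0)"
    unfolding boson_def prod.case using LM
    by (intro sum.cong) (auto simp: burge_B_def q_binom_def q_fact_def)
  also have "\<dots> = 1" using assms by simp
  finally show ?thesis using LM by simp
next
  case False
  define N where "N = L + M"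
  have N: "1 \<le> N" using False assms by (auto simp: N_def)
  \<comment> \<open>Apply Pascal to one binomial of each summand: both then contain
    \<open>q powi (j * (j + 1)) * [N; L+j] * [N-1; L-j-1]\<close>, which cancels, and
    \<open>H j - H (j + 1)\<close> remains.\<close>
  define H where "H j = q powi (j * j + L) * (q_binom q N (L + j) * q_binom q (N - 1) (L - j))" for j
  have step: "q powi (j * (1 * 1 * j + 1)) * burge_B L M (1 * j) (1 * j)
     - q powi ((1 * j + 1) * (1 * j + 0)) * burge_B L M (1 * j + 1) (1 * j + 0) = H j - H (j + 1)" for j
  proof -
    have 1: "q_binom q (N + 1) (L + j + 1) = q_binom q N (L + j) + q powi (L + j + 1) * q_binom q N (L + j + 1)"
      using q_binom_pascal[of "N + 1" "L + j + 1"] N by simp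
    have 2: "q_binom q N (L - j) = q_binom q (N - 1) (L - j - 1) + q powi (L - j) * q_binom q (N - 1) (L - j)"
      using q_binom_pascal[of N "L - j"] N by simp
    have "burge_B L M (1 * j) (1 * j) = q_binom q N (L + j) * q_binom q N (L - j)"
      by (simp add: burge_B_def N_def)
    moreover have "burge_B L M (1 * j + 1) (1 * j + 0) = q_binom q (N + 1) (L + j + 1) *
        q_binom q (N - 1) (L - j - 1)"
      by (simp add: burge_B_def N_def algebra_simps)
    moreover have "q powi (j * j + L) = q powi (j * (j + 1)) * q powi (L - j)"
      using q_nonzero by (simp add: power_int_add[symmetric] algebra_simps)
    moreover have "q powi ((j + 1) * (j + 1) + L) = q powi (j * (j + 1)) * q powi (L + j + 1)"
      using q_nonzero by (simp add: power_int_add[symmetric] algebra_simps)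
    moreover have "L + (j + 1) = L + j + 1" "L - (j + 1) = L - j - 1" by simp_all
    ultimately show ?thesis unfolding H_def 1 2 by (simp add: algebra_simps)
  qed
  have tel: "(\<Sum>j=a..b. H j - H (j + 1)) = H a - H (b + 1)" if "a \<le> b" for a b
    using that
  proof (induction b rule: int_ge_induct)
    case (step b)
    have "{a..b + 1} = insert (b + 1) {a..b}" using step by auto
    thus ?case using step by simp
  qed simp
  have "boson {-K..K} (1, 1) (1, 0) L M = H (- K) - H (K + 1)"
    unfolding boson_def prod.case step using assms by (intro tel) simp
  also have "\<dots> = 0" using assms by (simp add: H_def q_binom_eq_0)
  finally show ?thesis using False by auto
qed

text \<open>One normal step from the pair \<open>(1, 1)\<close>, where only \<open>i = L = 0\<close>
  contributes. For \<open>e = 1\<close> the start \<open>(0, 1)\<close> is the swap of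
  \<open>(1, 0)\<close>.\<close>

lemma boson_2_1:
  assumes "0 \<le> L" "0 \<le> M" "L + M < K" "e \<in> {0, 1}"
  shows "boson {-K..K} (2, 1) (1, e) L M = of_bool (L = 0)"
proof -
  have base: "boson {-K..K} (1, 1) (1 - e, e) (L - i) i = of_bool (L - i = 0 \<and> i = 0)" if "i \<in> {0..L}" for i
    using assms that boson_1_1[of "L - i" i K] boson_1_1[of i "L - i" K] boson_swap[of _ 1 1 "1 - e" e "L - i" i]
    by auto
  have "boson {-K..K} (1 + 1, 1) (1 - e + e, e) L M =
    (\<Sum>i=0..L. q powi (i * i) * q_binom q (2 * L + M - i) (2 * L) * boson {-K..K} (1, 1) (1 - e, e) (L - i) i)"
    using assms by (intro boson_normal_step) auto
  also have "\<dots> = (\<Sum>i=0..L. if i = 0 \<and> L = 0 then 1 else 0)"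
    using assms by (intro sum.cong) (auto simp: base q_binom_0_right)
  also have "\<dots> = of_bool (L = 0)"
    by auto
  finally show ?thesis by simp
qed

end

section \<open>Continued fractions as words in two Euclidean steps\<close>

text \<open>The \<open>+ 2\<close> in the last partial quotient is absorbed by letting the word act on the
  pair \<open>(2, 1)\<close>.\<close>

fun cf_turns :: "nat \<Rightarrow> (nat \<Rightarrow> nat) \<Rightarrow> bool list" where
  "cf_turns 0 \<nu> = replicate (\<nu> 0) False"
| "cf_turns (Suc n) \<nu> = replicate (\<nu> 0 - 1) False @ True # cf_turns n (\<lambda>i. \<nu> (Suc i))"

text \<open>On the ratio \<open>z = x / y\<close>, \<open>False\<close> acts as \<open>z + 1\<close>
  and \<open>True\<close> as \<open>1 + 1 / z\<close>; the head of the word acts last.\<close>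

fun turn_pair :: "bool list \<Rightarrow> int \<times> int \<Rightarrow> int \<times> int" where
  "turn_pair [] z = z"
| "turn_pair (t # bs) z = (case turn_pair bs z of (x, y) \<Rightarrow> (x + y, if t then x else y))"

lemma turn_pair_add:
  "turn_pair bs (x + x', y + y') = (fst (turn_pair bs (x, y)) + fst (turn_pair bs (x', y')),
     snd (turn_pair bs (x, y)) + snd (turn_pair bs (x', y')))"
  by (induction bs) (auto simp: case_prod_unfold)

lemma turn_pair_nonneg:
  "0 \<le> x \<Longrightarrow> 0 \<le> y \<Longrightarrow> 0 \<le> fst (turn_pair bs (x, y)) \<and> 0 \<le> snd (turn_pair bs (x, y))"
  by (induction bs) (auto simp: case_prod_unfold)

lemma turn_pair_pos:
  "0 < x \<Longrightarrow> 0 < y \<Longrightarrow> 0 < fst (turn_pair bs (x, y)) \<and> 0 < snd (turn_pair bs (x, y))"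
  by (induction bs) (auto simp: case_prod_unfold)

text \<open>Linearity and \<open>(2, 1) = (1, 0) + (1, 1)\<close>. The images for
  \<open>e = 0\<close> and \<open>e = 1\<close> thus complement each other inside the image of
  \<open>(2, 1)\<close>, which bounds both.\<close>

lemma turn_pair_2_1:
  "turn_pair bs (2, 1) = (fst (turn_pair bs (1, 0)) + fst (turn_pair bs (1, 1)),
     snd (turn_pair bs (1, 0)) + snd (turn_pair bs (1, 1)))"
  using turn_pair_add[of bs 1 1 0 1] by simp

lemma turn_pair_le:
  assumes "e \<in> {0, 1}"
  shows "0 \<le> fst (turn_pair bs (1, e)) \<and> fst (turn_pair bs (1, e)) \<le> fst (turn_pair bs (2, 1)) \<and>
    0 \<le> snd (turn_pair bs (1, e)) \<and> snd (turn_pair bs (1, e)) \<le> snd (turn_pair bs (2, 1))"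
  using assms turn_pair_nonneg[of 1 0 bs] turn_pair_nonneg[of 1 1 bs] by (auto simp: turn_pair_2_1)

text \<open>Each letter acts with determinant 1 or -1.\<close>

lemma turn_pair_det:
  "\<bar>fst (turn_pair bs (x, y)) * snd (turn_pair bs (x', y')) - snd (turn_pair bs (x, y)) *
      fst (turn_pair bs (x', y'))\<bar>
   = \<bar>x * y' - y * x'\<bar>"
proof (induction bs)
  case (Cons t bs)
  obtain a b where 1: "turn_pair bs (x, y) = (a, b)" by fastforce
  obtain c d where 2: "turn_pair bs (x', y') = (c, d)" by fastforce
  have "(a + b) * c - a * (c + d) = - (a * d - b * c)" "(a + b) * d - b * (c + d) = a * d - b * c"
    by (simp_all add: algebra_simps)
  thus ?case using Cons.IH by (cases t) (simp_all add: 1 2)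
qed simp

lemma cfrac_turn_pair:
  assumes "\<forall>i<n. 1 \<le> \<nu> i"
  shows "cfrac \<nu> n = of_int (fst (turn_pair (cf_turns n \<nu>) (2,
      1))) / of_int (snd (turn_pair (cf_turns n \<nu>) (2, 1)))"
proof -
  have rep: "turn_pair (replicate k False @ bs) z = (fst (turn_pair bs z) + int k * snd (turn_pair bs z),
      snd (turn_pair bs z))"
    for k bs z by (induction k) (auto simp: algebra_simps)
  show ?thesis using assms
  proof (induction n arbitrary: \<nu>)
    case 0
    show ?case using rep[of "\<nu> 0" "[]" "(2, 1)"] by simp
  next
    case (Suc n)
    define z where "z = turn_pair (cf_turns n (\<lambda>i. \<nu> (Suc i))) (2, 1)"
    have z: "0 < fst z" "0 < snd z" using turn_pair_pos[of 2 1] by (auto simp: z_def)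
    have IH: "cfrac (\<lambda>i. \<nu> (Suc i)) n = of_int (fst z) / of_int (snd z)"
      unfolding z_def using Suc.prems by (intro Suc.IH) auto
    have "1 \<le> \<nu> 0" using Suc.prems by auto
    thus ?case using z
      by (simp add: rep IH z_def[symmetric] case_prod_unfold of_nat_diff field_simps)
  qed
qed

text \<open>The image of \<open>(2, 1)\<close> has determinant 1 or -1 against the image of
  \<open>(1, 1)\<close>, so its entries are coprime; two reduced fractions with positive
  denominators and equal value coincide.\<close>

lemma turn_pair_top:
  assumes "cfrac_expansion (of_int p' / of_int p) n \<nu>" "0 < p" "gcd p p' = 1"
  shows "turn_pair (cf_turns n \<nu>) (2, 1) = (p', p)"
proof -
  obtain x y where xy: "turn_pair (cf_turns n \<nu>) (2, 1) = (x, y)" by fastforce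
  obtain s r where sr: "turn_pair (cf_turns n \<nu>) (1, 1) = (s, r)" by fastforce
  have pos: "0 < y" using turn_pair_pos[of 2 1 "cf_turns n \<nu>"] xy by simp
  have "\<bar>x * r - y * s\<bar> = 1" using turn_pair_det[of "cf_turns n \<nu>" 2 1 1 1] xy sr by simp
  hence "is_unit (x * r - y * s)" by (metis dvd_abs_iff dvd_refl)
  hence "coprime x y" by (intro coprimeI) (meson dvd_diff dvd_mult2 dvd_trans)
  moreover have "coprime p' p" using assms(3) by (simp add: coprime_iff_gcd_eq_1 gcd.commute)
  moreover have "of_int p' / of_int p = (of_int x / of_int y :: rat)"
    using assms(1) cfrac_turn_pair[of n \<nu>] xy by (simp add: cfrac_expansion_def)
  hence "of_int (p' * y) = (of_int (x * p) :: rat)" using pos assms(2) by (simp add: field_simps)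
  hence "p' * y = x * p" by (simp only: of_int_eq_iff)
  ultimately have "p' = x \<and> p = y"
    using coprime_crossproduct'[of p y p' x] pos assms(2) by (auto simp: mult.commute)
  thus ?thesis using xy by simp
qed

text \<open>The images for \<open>e = 0\<close> and \<open>e = 1\<close> give
  \<open>p' * r - p * s\<close> the values 1 and -1 in some order. For a fixed value
  \<open>r\<close> is determined modulo \<open>p\<close>, and the bounds leave one choice.\<close>

lemma turn_pair_unique:
  fixes p p' r s :: int
  assumes "turn_pair bs (2, 1) = (p', p)" "gcd p p' = 1" "1 \<le> r" "r < p" "\<bar>p' * r - p * s\<bar> = 1"
  shows "\<exists>e\<in>{0, 1}. turn_pair bs (1, e) = (s, r)"
proof -
  have p: "0 < p" using assms by simp
  have eq: "turn_pair bs (1, e) = (s, r)"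
    if e: "e \<in> {0, 1}" and "p' * snd (turn_pair bs (1, e)) - p * fst (turn_pair bs (1, e)) = p' * r - p *
        s" for e
  proof -
    obtain s0 r0 where sr: "turn_pair bs (1, e) = (s0, r0)" by fastforce
    have "0 \<le> r0" "r0 \<le> p" using turn_pair_le[OF e, of bs] sr assms(1) by auto
    have *: "p' * (r0 - r) = p * (s0 - s)" using that sr by (simp add: algebra_simps)
    hence "p dvd p' * (r0 - r)" by simp
    hence "p dvd r0 - r" using assms(2) by (simp add: coprime_dvd_mult_right_iff coprime_iff_gcd_eq_1)
    moreover have "\<bar>r0 - r\<bar> < \<bar>p\<bar>" using \<open>0 \<le> r0\<close> \<open>r0 \<le> p\<close> assms(3,4) by linarith
    ultimately have "r0 = r" using dvd_imp_le_int[of "r0 - r" p] by auto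
    moreover from this have "s0 = s" using * p by simp
    ultimately show ?thesis using sr by simp
  qed
  define D where "D e = p' * snd (turn_pair bs (1, e)) - p * fst (turn_pair bs (1, e))" for e
  have "\<bar>D e\<bar> = 1" if "e \<in> {0, 1}" for e
    using turn_pair_det[of bs 2 1 1 e] assms(1) that by (auto simp: D_def)
  moreover have "D 0 + D 1 = 0"
    using turn_pair_2_1[of bs] assms(1) by (simp add: D_def algebra_simps)
  ultimately have "D 0 = p' * r - p * s \<or> D 1 = p' * r - p * s" using assms(5) by (smt (verit) insertCI)
  thus ?thesis using eq unfolding D_def by blast
qed

lemma length_cf_turns:
  assumes "\<forall>i<n. 1 \<le> \<nu> i"
  shows "length (cf_turns n \<nu>) = dim1 n \<nu>"
  using assms
proof (induction n arbitrary: \<nu>)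
  case (Suc n)
  have "length (cf_turns n (\<lambda>i. \<nu> (Suc i))) = dim1 n (\<lambda>i. \<nu> (Suc i))" using Suc.prems by (intro Suc.IH) auto
  moreover have "1 \<le> \<nu> 0" using Suc.prems by auto
  ultimately show ?case by (simp add: dim1_def sum.atMost_Suc_shift del: sum.atMost_Suc)
qed (simp add: dim1_def)

text \<open>Splitting off the first partial quotient shifts all \<open>tpos\<close> by
  \<open>\<nu> 0\<close>; the new \<open>True\<close> at index \<open>\<nu> 0 - 1\<close> is the
  case \<open>m = 1\<close>. If \<open>\<nu> n = 0\<close> and \<open>1 \<le> n\<close>, then
  \<open>tpos \<nu> n\<close> is the last position.\<close>

lemma cf_turns_nth:
  assumes "\<forall>i<n. 1 \<le> \<nu> i" "i < dim1 n \<nu>"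
  shows "cf_turns n \<nu> ! i \<longleftrightarrow> (\<exists>m\<in>{1..n}. Suc i = tpos \<nu> m)"
  using assms
proof (induction n arbitrary: \<nu> i)
  case (Suc n)
  define \<mu> where "\<mu> = (\<lambda>i. \<nu> (Suc i))"
  have nu: "1 \<le> \<nu> 0" "\<forall>i<n. 1 \<le> \<mu> i" using Suc.prems by (auto simp: \<mu>_def)
  have d: "dim1 (Suc n) \<nu> = \<nu> 0 + dim1 n \<mu>"
      by (simp add: dim1_def sum.atMost_Suc_shift \<mu>_def del: sum.atMost_Suc)
  have t: "tpos \<nu> (Suc m) = \<nu> 0 + tpos \<mu> m" for m
      by (simp add: tpos_def sum.lessThan_Suc_shift \<mu>_def del: sum.lessThan_Suc)
  have "(\<exists>m\<in>{1..Suc n}. Suc i = tpos \<nu> m) \<longleftrightarrow> (\<exists>m\<in>{0..n}. Suc i = tpos \<nu> (Suc m))"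
    by (auto simp: image_Suc_atLeastAtMost[symmetric] simp del: image_Suc_atLeastAtMost)
  also have "\<dots> \<longleftrightarrow> Suc i = \<nu> 0 \<or> (\<exists>m\<in>{1..n}. Suc i = \<nu> 0 + tpos \<mu> m)"
  proof -
    have "{0..n} = insert 0 {1..n}" by auto
    thus ?thesis by (simp add: t) (simp add: tpos_def)
  qed
  also have "\<dots> \<longleftrightarrow> cf_turns (Suc n) \<nu> ! i"
  proof -
    have pos: "1 \<le> tpos \<mu> m" if "m \<in> {1..n}" for m
    proof -
      have "\<mu> 0 \<le> tpos \<mu> m" unfolding tpos_def using that by (intro member_le_sum) auto
      moreover have "1 \<le> \<mu> 0" using nu that by auto
      ultimately show ?thesis by simp
    qed
    consider "Suc i < \<nu> 0" | "Suc i = \<nu> 0" | j where "i = \<nu> 0 + j"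
        by (metis le_Suc_ex linorder_neqE_nat not_less_eq_eq less_Suc_eq_le)
    thus ?thesis
    proof cases
      case 1
      thus ?thesis by (auto simp: nth_append)
    next
      case 2
      thus ?thesis by (auto simp: nth_append)
    next
      case 3
      have "cf_turns (Suc n) \<nu> ! i = cf_turns n \<mu> ! j"
      proof -
        have "\<not> i < \<nu> 0 - 1" "i - (\<nu> 0 - 1) = Suc j" using 3 nu by auto
        thus ?thesis by (simp add: nth_append \<mu>_def)
      qed
      also have "\<dots> \<longleftrightarrow> (\<exists>m\<in>{1..n}. Suc j = tpos \<mu> m)" using Suc.IH[of \<mu> j] nu Suc.prems(2) 3 d by simp
      finally show ?thesis using 3 by auto
    qed
  qed
  finally show ?case by simp
qed (simp add: dim1_def)

section \<open>Fermionic sums\<close>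

context generic_q
begin

text \<open>The weight of one Burge step with \<open>a = L + M\<close> and \<open>b = L\<close>. The
  first argument of the remaining bosonic sum is \<open>c\<close>: it is \<open>i\<close> after a
  turn and \<open>L - i\<close> after a normal step.\<close>

definition fermion_step :: "bool \<Rightarrow> int \<Rightarrow> int \<Rightarrow> int \<Rightarrow> 'a" where
  "fermion_step t a b c =
     (if t then q powi (c * c) * q_binom q (a + b - c) (2 * b)
      else q powi ((b - c) * (b - c)) * q_binom q (a + c) (2 * b))"

fun fermion :: "bool list \<Rightarrow> int \<Rightarrow> int \<Rightarrow> 'a" where
  "fermion [] a b = of_bool (b = 0)"
| "fermion (t # bs) a b = (\<Sum>c=0..b. fermion_step t a b c * fermion bs b c)"

text \<open>One \<open>K\<close> serves the whole induction, since the inner arguments add up to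
  \<open>L \<le> L + M\<close>. The same fact makes \<open>b\<close> the first argument of the inner
  \<open>fermion\<close>.\<close>

lemma boson_eq_fermion:
  assumes "0 \<le> L" "0 \<le> M" "L + M < K" "e \<in> {0, 1}"
  shows "boson {-K..K} (turn_pair bs (2, 1)) (turn_pair bs (1, e)) L M = fermion bs (L + M) L"
  using assms(1-3)
proof (induction bs arbitrary: L M)
  case Nil
  thus ?case using boson_2_1 assms(4) by simp
next
  case (Cons t bs)
  obtain p' p where p: "turn_pair bs (2, 1) = (p', p)" by fastforce
  obtain s r where s: "turn_pair bs (1, e) = (s, r)" by fastforce
  have le: "0 \<le> s" "s \<le> p'" "0 \<le> r" "r \<le> p"
    using turn_pair_le[OF assms(4), of bs] p s by auto
  have IH: "boson {-K..K} (p', p) (s, r) i (L - i) = fermion bs L i" if "i \<in> {0..L}" for i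
    using Cons.IH[of i "L - i"] Cons.prems that by (simp add: p s)
  show ?case
  proof (cases t)
    case True
    have "(\<Sum>i=0..L. q powi (i * i) * q_binom q (2 * L + M - i) (2 * L) * boson {-K..K} (p', p) (s, r) i (L - i))
      = fermion (t # bs) (L + M) L"
      using True by (auto simp: IH fermion_step_def algebra_simps intro!: sum.cong)
    thus ?thesis using True boson_turn_step[OF le] by (simp add: p s)
  next
    case False
    have "(\<Sum>i=0..L. q powi (i * i) * q_binom q (2 * L + M - i) (2 * L) * boson {-K..K} (p', p) (s, r) (L - i) i)
      = (\<Sum>c=0..L. q powi ((L - c) * (L - c)) * q_binom q (L + M + c) (2 * L) * boson {-K..K} (p', p) (s,
          r) c (L - c))"
    proof (rule sum.reindex_bij_witness[of _ "\<lambda>c. L - c" "\<lambda>c. L - c"])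
      fix i
      have "L + M + (L - i) = 2 * L + M - i" "L - (L - i) = i" by simp_all
      thus "q powi ((L - (L - i)) * (L - (L - i))) * q_binom q (L + M + (L - i)) (2 * L) *
          boson {-K..K} (p', p) (s, r) (L - i) (L - (L - i)) =
        q powi (i * i) * q_binom q (2 * L + M - i) (2 * L) * boson {-K..K} (p', p) (s, r) (L - i) i"
        by (simp only:)
    qed auto
    also have "\<dots> = fermion (t # bs) (L + M) L"
      using False by (auto simp: IH fermion_step_def intro!: sum.cong)
    finally show ?thesis using False boson_normal_step[OF le] by (simp add: p s)
  qed
qed

text \<open>This allows the ranges \<open>0..b\<close> to be enlarged to a common one, so that
  nested sums become a sum over a box.\<close>

lemma fermion_eq_0:
  assumes "0 \<le> a" "a < b"
  shows "fermion bs a b = 0"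
  using assms by (cases bs) (auto simp: fermion_step_def q_binom_eq_0 intro!: sum.neutral)

lemma fermion_Cons_atMost:
  assumes "0 \<le> b" "b \<le> K"
  shows "fermion (t # bs) a b = (\<Sum>c=0..K. fermion_step t a b c * fermion bs b c)"
  unfolding fermion.simps using assms by (intro sum.mono_neutral_left) (auto simp: fermion_eq_0)

section \<open>Reduction of the trinomial side\<close>

lemma q_trinom_even:
  "q_trinom q L (2 * b) = (\<Sum>a=0..L. q powi (a * a - b * b) * q_binom q L (2 * a) * q_binom q (2 * a) (a - b))"
proof -
  \<comment> \<open>With \<open>a = k + b\<close> only \<open>[L; 2a]\<close> still depends on
    \<open>L\<close>, and \<open>k * (k + 2 * b)\<close> equals
    \<open>a * a - b * b\<close>.\<close>
  have rev: "q_binom q L k * q_binom q (L - k) (k + 2 * b) = q_binom q L (2 * (k + b)) * q_binom q (2 * (k +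
      b)) k" for k
    using q_binom_mult_q_binom[of L k "k + 2 * b"] by (simp add: algebra_simps)
  have "q_trinom q L (2 * b) = (\<Sum>k=0..L. q powi (k * (k + 2 * b)) * (q_binom q L (2 * (k + b)) *
      q_binom q (2 * (k + b)) k))"
    by (simp add: q_trinom2_def rev mult.assoc)
  also have "\<dots> = (\<Sum>k=- b..L - b. q powi (k * (k + 2 * b)) * (q_binom q L (2 * (k + b)) * q_binom q (2 * (k +
      b)) k))"
    by (rule sum.mono_neutral_cong) (auto simp: q_binom_def)
  also have "\<dots> = (\<Sum>a=0..L. q powi (a * a - b * b) * q_binom q L (2 * a) * q_binom q (2 * a) (a - b))"
  proof (rule sum.reindex_bij_witness[of _ "\<lambda>a. a - b" "\<lambda>k. k + b"])
    fix k
    have "k * (k + 2 * b) = (k + b) * (k + b) - b * b" by (simp add: algebra_simps)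
    thus "q powi ((k + b) * (k + b) - b * b) * q_binom q L (2 * (k + b)) * q_binom q (2 * (k + b)) (k + b - b) =
      q powi (k * (k + 2 * b)) * (q_binom q L (2 * (k + b)) * q_binom q (2 * (k + b)) k)"
      by simp
  qed auto
  finally show ?thesis .
qed

text \<open>Expanding the trinomials gives the sum over \<open>a\<close> and lowers
  \<open>p + p'\<close> to \<open>p\<close> in the exponents. The leading \<open>True\<close> is
  then undone by \<open>boson_turn_limit\<close>, which gives the sum over \<open>b\<close>.\<close>

lemma sum_bose_term_eq_fermion:
  assumes "turn_pair (True # bs) (2, 1) = (p', p)" "turn_pair (True # bs) (1, e) = (s, r)" "e \<in> {0, 1}"
    and "L < K"
  shows "(\<Sum>j=-K..K. bose_term q p p' r s L j) =
    (\<Sum>a=0..L. \<Sum>b=0..L. q_binom q L (2 * a) * (q powi (a * a) * q powi (b * b)) * fermion bs a b)"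
proof -
  obtain x y where xy: "turn_pair bs (2, 1) = (x, y)" by fastforce
  obtain u v where uv: "turn_pair bs (1, e) = (u, v)" by fastforce
  have eqs: "p' = x + y" "p = x" "s = u + v" "r = u" using assms(1,2) xy uv by auto
  have le: "0 \<le> u" "u \<le> x" "0 \<le> v" "v \<le> y"
    using turn_pair_le[OF assms(3), of bs] xy uv by auto
  \<comment> \<open>The summand on the right of \<open>boson_turn_limit\<close> at
    \<open>L = a\<close>, written in \<open>p'\<close>, \<open>p\<close>, \<open>s\<close>,
    \<open>r\<close>.\<close>
  define X where "X a j = q powi (j * (p * p' * j + 1)) * q_binom q (2 * a) (a - p' * j)
      - q powi ((p' * j + s) * (p * j + r)) * q_binom q (2 * a) (a - (p' * j + s))" for a j
  have bose: "bose_term q p p' r s L j = (\<Sum>a=0..L. q_binom q L (2 * a) * q powi (a * a) * X a j)" for j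
  proof -
    have 1: "q powi (j * (p' * (p + p') * j + 1)) * q_trinom q L (2 * p' * j) =
      (\<Sum>a=0..L. q_binom q L (2 * a) * q powi (a * a) * (q powi (j * (p * p' * j + 1)) * q_binom q (2 *
          a) (a - p' * j)))"
    proof -
      have "q powi (j * (p' * (p + p') * j + 1)) * q powi (a * a - p' * j * (p' * j)) = q powi (a * a) *
          q powi (j * (p * p' * j + 1))" for a
        using q_nonzero by (simp add: power_int_add[symmetric] algebra_simps)
      hence "q powi (j * (p' * (p + p') * j + 1)) * (q powi (a * a - p' * j * (p' * j)) * u * v) = u *
          q powi (a * a) * (q powi (j * (p * p' * j + 1)) * v)" for a u v
        by (simp add: mult_ac)
      thus ?thesis
        unfolding mult.assoc[of 2] q_trinom_even sum_distrib_left by (simp only:)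
    qed
    have 2: "q powi ((p' * j + s) * ((p + p') * j + r + s)) * q_trinom q L (2 * p' * j + 2 * s) =
      (\<Sum>a=0..L. q_binom q L (2 * a) * q powi (a * a) * (q powi ((p' * j + s) * (p * j + r)) * q_binom q (2 *
          a) (a - (p' * j + s))))"
    proof -
      have "q powi ((p' * j + s) * ((p + p') * j + r + s)) * q powi (a * a - (p' * j + s) * (p' * j + s)) =
          q powi (a * a) * q powi ((p' * j + s) * (p * j + r))" for a
        using q_nonzero by (simp add: power_int_add[symmetric] algebra_simps)
      hence "q powi ((p' * j + s) * ((p + p') * j + r + s)) * (q powi (a * a - (p' * j + s) * (p' * j + s))
          * u * v) = u * q powi (a * a) * (q powi ((p' * j + s) * (p * j + r)) * v)" for a u v
        by (simp add: mult_ac)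
      moreover have e: "2 * p' * j + 2 * s = 2 * (p' * j + s)" by simp
      ultimately show ?thesis
        unfolding e q_trinom_even sum_distrib_left by (simp only:)
    qed
    show ?thesis unfolding bose_term_def 1 2 X_def by (simp add: sum_subtractf right_diff_distrib)
  qed
  have X: "(\<Sum>j=-K..K. X a j) = (\<Sum>b=0..L. q powi (b * b) * fermion bs a b)" if "a \<in> {0..L}" for a
  proof -
    have "(\<Sum>j=-K..K. X a j) = (\<Sum>b=0..a. q powi (b * b) * boson {-K..K} (x, y) (u, v) b (a - b))"
      unfolding boson_turn_limit[OF le] X_def eqs ..
    also have "\<dots> = (\<Sum>b=0..a. q powi (b * b) * fermion bs a b)"
      using boson_eq_fermion[of _ "a - _" K e bs] that assms(3,4)
      by (intro sum.cong refl) (auto simp: xy uv)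
    also have "\<dots> = (\<Sum>b=0..L. q powi (b * b) * fermion bs a b)"
      using that by (intro sum.mono_neutral_left) (auto simp: fermion_eq_0)
    finally show ?thesis .
  qed
  have "(\<Sum>j=-K..K. bose_term q p p' r s L j) = (\<Sum>a=0..L. q_binom q L (2 * a) * q powi (a * a) *
      (\<Sum>j=-K..K. X a j))"
    unfolding bose sum_distrib_left by (rule sum.swap)
  also have "\<dots> = (\<Sum>a=0..L. \<Sum>b=0..L. q_binom q L (2 * a) * (q powi (a * a) * q powi (b * b)) * fermion bs a b)"
    by (intro sum.cong refl) (simp add: X sum_distrib_left mult.assoc)
  finally show ?thesis .
qed

end

section \<open>The matrices in halved coordinates\<close>

lemma sum_PiE_insert:
  assumes "x \<notin> S"
  shows "(\<Sum>h\<in>Pi\<^sub>E (insert x S) T. F h) = (\<Sum>g\<in>Pi\<^sub>E S T. \<Sum>y\<in>T x. F (g(x := y)))"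
proof -
  have "(\<Sum>h\<in>Pi\<^sub>E (insert x S) T. F h) = (\<Sum>(y, g)\<in>T x \<times> Pi\<^sub>E S T. F (g(x := y)))"
    unfolding PiE_insert_eq by (subst sum.reindex[OF inj_combinator[OF assms]]) (simp add: case_prod_unfold)
  also have "\<dots> = (\<Sum>y\<in>T x. \<Sum>g\<in>Pi\<^sub>E S T. F (g(x := y)))"
    by (simp add: sum.cartesian_product)
  also have "\<dots> = (\<Sum>g\<in>Pi\<^sub>E S T. \<Sum>y\<in>T x. F (g(x := y)))" by (rule sum.swap)
  finally show ?thesis .
qed

lemma atLeastAtMost_add_2: "{1..Suc (Suc k)} = insert 1 (insert 2 ((\<lambda>j. j + 3) ` {..<k}))"
proof -
  have "(\<lambda>j. j + 3) ` {..<k} = {3..<k + 3}"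
    using image_add_atLeastLessThan'[of 3 0 k] by (simp add: atLeast0LessThan)
  thus ?thesis by auto
qed

lemma sum_add_2: "(\<Sum>j=1..Suc (Suc k). f j) = f 1 + (f 2 + (\<Sum>j<k. f (j + 3)))"
  unfolding atLeastAtMost_add_2 by (simp add: sum.reindex image_iff)

lemma prod_add_2: "(\<Prod>j=1..Suc (Suc k). f j) = f 1 * (f 2 * (\<Prod>j<k. f (j + 3)))"
  unfolding atLeastAtMost_add_2 by (simp add: prod.reindex image_iff)

text \<open>With \<open>m\<^sub>1 + m\<^sub>2 = 2 x\<^sub>1\<close> and \<open>m\<^sub>j = 2 x\<^bsub>j-1\<^esub>\<close> for \<open>j \<ge> 3\<close>, the summation vectors become
  arbitrary integer vectors \<open>x\<close> together with the free coordinate \<open>m\<^sub>1 = i\<close>.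
  The extra last coordinate of \<open>x\<close> is always \<open>0\<close>.\<close>

definition m_vec :: "nat \<Rightarrow> int \<Rightarrow> (nat \<Rightarrow> int) \<Rightarrow> nat \<Rightarrow> int" where
  "m_vec d i x = (\<lambda>j\<in>{1..d}. if j = 1 then i else if j = 2 then 2 * x 1 - i else 2 * x (j - 1))"

context
  fixes n :: nat and \<nu> :: "nat \<Rightarrow> nat" and bs :: "bool list"
  assumes n: "1 \<le> n" "\<nu> 0 = 1" "\<forall>i<n. 1 \<le> \<nu> i"
    and bs: "cf_turns n \<nu> = True # bs"
begin

lemma dim1_bs: "dim1 n \<nu> = Suc (length bs)"
  using length_cf_turns[OF n(3)] bs by simp

lemma dim2_bs: "dim2 n \<nu> = Suc (Suc (length bs))"
  by (simp add: dim2_def dim1_bs)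

lemma tpos_le: "m \<le> n \<Longrightarrow> tpos \<nu> m + \<nu> n \<le> dim1 n \<nu>"
proof -
  assume "m \<le> n"
  hence "(\<Sum>j\<in>insert n {..<m}. \<nu> j) \<le> dim1 n \<nu>" unfolding dim1_def by (intro sum_mono2) auto
  thus ?thesis using \<open>m \<le> n\<close> by (simp add: tpos_def)
qed

lemma tpos_n: "tpos \<nu> n + \<nu> n = dim1 n \<nu>"
  by (simp add: tpos_def dim1_def lessThan_Suc_atMost[symmetric])

text \<open>Dropping the leading \<open>True\<close> shifts indices: \<open>bs ! j\<close> belongs
  to row \<open>j + 2\<close> of \<open>I1\<close> and hence to row \<open>j + 3\<close> of
  \<open>I2\<close>.\<close>

lemma bs_nth: "j < length bs \<Longrightarrow> bs ! j \<longleftrightarrow> (\<exists>m\<in>{1..n}. j + 2 = tpos \<nu> m)"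
  using cf_turns_nth[OF n(3), of "Suc j"] by (simp add: bs dim1_bs)

text \<open>If \<open>\<nu> n = 0\<close>, then \<open>tpos \<nu> n\<close> is the last row; the set
  of turning rows omits it, but the last row has its own diagonal entry for exactly this case. One
  rule in terms of \<open>bs\<close> therefore covers all rows.\<close>

lemma I1_diag:
  assumes "j < length bs"
  shows "I1 n \<nu> (j + 2) (j + 2) = of_bool (bs ! j)"
    and "j + 2 < dim1 n \<nu> \<Longrightarrow> I1 n \<nu> (j + 2) (j + 3) = (if bs ! j then - 1 else 1)"
proof -
  have last: "(\<exists>m\<in>{1..n}. dim1 n \<nu> = tpos \<nu> m) \<longleftrightarrow> \<nu> n = 0"
  proof
    assume "\<exists>m\<in>{1..n}. dim1 n \<nu> = tpos \<nu> m"
    thus "\<nu> n = 0" using tpos_le by fastforce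
  next
    assume "\<nu> n = 0"
    thus "\<exists>m\<in>{1..n}. dim1 n \<nu> = tpos \<nu> m" using tpos_n n(1) by (intro bexI[of _ n]) auto
  qed
  have inner: "(\<exists>m\<in>{1..n - of_bool (\<nu> n = 0)}. j + 2 = tpos \<nu> m) \<longleftrightarrow> bs ! j" if "j + 2 \<noteq> dim1 n \<nu>"
  proof (cases "\<nu> n = 0")
    case True
    hence "{1..n} = insert n {1..n - of_bool (\<nu> n = 0)}" using n(1) by auto
    thus ?thesis unfolding bs_nth[OF assms] using True that tpos_n by auto
  qed (simp add: bs_nth[OF assms])
  show "I1 n \<nu> (j + 2) (j + 2) = of_bool (bs ! j)"
    using last inner bs_nth[OF assms] by (auto simp: I1_def)
  show "I1 n \<nu> (j + 2) (j + 3) = (if bs ! j then - 1 else 1)" if "j + 2 < dim1 n \<nu>"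
    using inner that by (auto simp: I1_def)
qed

text \<open>The zero coordinate \<open>x (length bs + 2)\<close> stands for the missing column after
  the last one, so the last row obeys the general formula.\<close>

lemma I2_vec_m_vec:
  fixes i :: int
  assumes x: "x (length bs + 2) = 0"
  defines "m \<equiv> m_vec (dim2 n \<nu>) i x"
  shows "I2_vec n \<nu> m 1 = 2 * (x 2 - x 1)" "I2_vec n \<nu> m 2 = 2 * (x 1 - x 2)"
    and "j < length bs \<Longrightarrow> I2_vec n \<nu> m (j + 3) = 2 * (x (j + 1) + (if bs ! j then x (j + 2) - x (j +
        3) else x (j + 3)))"
proof -
  have m: "m 1 = i" "m 2 = 2 * x 1 - i" "\<And>j. j < length bs \<Longrightarrow> m (j + 3) = 2 * x (j + 2)"
    by (auto simp: m_def m_vec_def dim2_bs)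
  \<comment> \<open>For empty \<open>bs\<close> there is no third entry, and \<open>x 2\<close> is
    then the coordinate fixed to 0.\<close>
  have m3: "(if 3 \<le> dim2 n \<nu> then m 3 else 0) = 2 * x 2"
    using m(3)[of 0] x by (cases bs) (auto simp: dim2_bs numeral_2_eq_2)
  show "I2_vec n \<nu> m 1 = 2 * (x 2 - x 1)" "I2_vec n \<nu> m 2 = 2 * (x 1 - x 2)"
    unfolding I2_vec_12[where n = n and \<nu> = \<nu>, OF n(1,2)] m3 m(1,2) by simp_all
  show "I2_vec n \<nu> m (j + 3) = 2 * (x (j + 1) + (if bs ! j then x (j + 2) - x (j + 3) else x (j + 3)))"
    if j: "j < length bs"
  proof -
    define c where "c = I1 n \<nu> (j + 2) (j + 3)"
    have row: "I2 n \<nu> (j + 3) (k + 3) = delta j (k + 1) + of_bool (bs ! j) * delta j k + c * delta (j +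
        1) k" for k
    proof -
      have "I2 n \<nu> (j + 3) (k + 3) = I1 n \<nu> (j + 2) (k + 2)" by (simp add: I2_def)
      also have "\<dots> = delta (j + 2) (k + 2 + 1) + I1 n \<nu> (j + 2) (j + 2) * delta (j + 2) (k + 2)
          + I1 n \<nu> (j + 2) (j + 2 + 1) * delta (j + 2 + 1) (k + 2)" by (rule I1_row)
      also have "\<dots> = delta j (k + 1) + of_bool (bs ! j) * delta j k + c * delta (j + 1) k"
        unfolding I1_diag(1)[OF j] by (simp add: c_def numeral_3_eq_3)
      finally show ?thesis .
    qed
    \<comment> \<open>Only row 3 meets the first two columns. It sees
      \<open>m 1 + m 2 = 2 * x 1\<close>, which plays the part of the preceding coordinate and is
      free of \<open>i\<close>.\<close>
    have col: "I2 n \<nu> (j + 3) 1 = delta j 0" "I2 n \<nu> (j + 3) 2 = delta j 0"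
      by (auto simp: I2_def I1_def)
    have "I2_vec n \<nu> m (j + 3) = delta j 0 * (2 * x 1) + (\<Sum>k<length bs. I2 n \<nu> (j + 3) (k + 3) * m (k + 3))"
      unfolding I2_vec_def dim2_bs sum_add_2 col m by (simp add: algebra_simps)
    also have "(\<Sum>k<length bs. I2 n \<nu> (j + 3) (k + 3) * m (k + 3)) =
      (\<Sum>k<length bs. (if k = j - 1 \<and> j \<noteq> 0 then 2 * x (k + 2) else 0) + (if k = j then of_bool (bs ! j) * (2
          * x (k + 2)) else 0)
        + (if k = j + 1 then c * (2 * x (k + 2)) else 0))"
      unfolding row by (intro sum.cong refl) (auto simp: m)
    also have "\<dots> = (if j \<noteq> 0 then 2 * x (j + 1) else 0) + of_bool (bs ! j) * (2 * x (j + 2))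
        + (if j + 1 < length bs then c * (2 * x (j + 3)) else 0)"
      using j by (cases j) (auto simp: sum.distrib numeral_3_eq_3)
    also have "(if j + 1 < length bs then c * (2 * x (j + 3)) else 0) = (if bs ! j then - 1 else 1) * (2 *
        x (j + 3))"
    proof (cases "j + 1 < length bs")
      case True
      thus ?thesis using I1_diag(2)[OF j] by (simp add: c_def dim1_bs)
    next
      case False
      hence "j + 3 = length bs + 2" using j by simp
      hence "x (j + 3) = 0" using x by (simp only:)
      thus ?thesis using False by simp
    qed
    finally show ?thesis by (cases j) (auto simp: algebra_simps)
  qed
qed

lemma B2_form_m_vec:
  assumes x: "x (length bs + 2) = 0"
  shows "\<lfloor>B2_form n \<nu> (m_vec (dim2 n \<nu>) i x) / 2\<rfloor> = i * i - (x 1 + x 2) * i + (x 1 * x 1 + x 2 * x 2 +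
     (\<Sum>j<length bs. if bs ! j then x (j + 3) * x (j + 3) else (x (j + 2) - x (j + 3)) * (x (j + 2) - x (j +
         3))))"
    (is "_ = ?E")
proof -
  define m where "m = m_vec (dim2 n \<nu>) i x"
  have m: "m 1 = i" "m 2 = 2 * x 1 - i" "\<And>j. j < length bs \<Longrightarrow> m (j + 3) = 2 * x (j + 2)"
    by (auto simp: m_def m_vec_def dim2_bs)
  note v = I2_vec_m_vec[where x = x and i = i, OF x, folded m_def]
  define e where "e j = (if bs ! j then x (j + 3) * x (j + 3) else (x (j + 2) - x (j + 3)) * (x (j +
      2) - x (j + 3)))" for j
  \<comment> \<open>Completing squares: each row contributes the exponent \<open>e j\<close> of a
    fermionic step plus a telescoping difference of \<open>h\<close>, and
    \<open>h (length bs)\<close> is 0 because the last coordinate is.\<close>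
  define h where "h j = x (j + 2) * x (j + 2) - x (j + 2) * x (j + 1)" for j
  have "m (j + 3) * (2 * m (j + 3) - I2_vec n \<nu> m (j + 3)) = 4 * (e j +
      (h j - h (Suc j)))" if "j < length bs" for j
    unfolding v(3)[OF that] m(3)[OF that] by (simp add: e_def h_def algebra_simps numeral_3_eq_3)
  hence "(\<Sum>j<length bs. m (j + 3) * (2 * m (j + 3) - I2_vec n \<nu> m (j + 3))) =
      (\<Sum>j<length bs. 4 * (e j + (h j - h (Suc j))))" by simp
  also have "\<dots> = 4 * ((\<Sum>j<length bs. e j) + (h 0 - h (length bs)))"
    by (simp only: sum_distrib_left[symmetric] sum.distrib sum_lessThan_telescope')
  also have "h 0 - h (length bs) = x 2 * x 2 - x 2 * x 1" using x by (simp add: h_def numeral_2_eq_2)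
  finally have "(\<Sum>j=1..dim2 n \<nu>. m j * (2 * m j - I2_vec n \<nu> m j)) = 4 * ?E"
    unfolding dim2_bs sum_add_2 v(1,2) m(1,2) e_def by (simp add: algebra_simps)
  hence "B2_form n \<nu> m / 2 = of_int ?E" unfolding B2_form_eq by simp
  thus ?thesis unfolding m_def by (simp only: floor_of_int)
qed

end

section \<open>Evaluation of the fermionic side\<close>

context generic_q
begin

lemma q_power_int_sum: "finite A \<Longrightarrow> q powi (\<Sum>j\<in>A. f j) = (\<Prod>j\<in>A. q powi f j)"
  by (induction A rule: finite_induct) (simp_all add: q_nonzero power_int_add)

text \<open>Rows from 3 on pair with the squares of the quadratic form into
  \<open>fermion_step\<close> weights; \<open>i\<close> occurs only in the first two binomials and
  one power of \<open>q\<close>.\<close>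

lemma fermi_term_m_vec:
  assumes n: "1 \<le> n" "\<nu> 0 = 1" "\<forall>i<n. 1 \<le> \<nu> i" and bs: "cf_turns n \<nu> = True # bs"
    and x: "x (length bs + 2) = 0"
  shows "fermi_term q n \<nu> L (m_vec (dim2 n \<nu>) i x) =
    q powi (i * i - (x 1 + x 2) * i) * q_binom q (L - x 1 + x 2) i * q_binom q (x 1 - x 2) (2 * x 1 - i) *
    (q powi (x 1 * x 1) * q powi (x 2 * x 2) *
      (\<Prod>j<length bs. fermion_step (bs ! j) (x (j + 1)) (x (j + 2)) (x (j + 3))))"
proof -
  note d = dim2_bs[OF n bs]
  define m where "m = m_vec (dim2 n \<nu>) i x"
  have m: "m 1 = i" "m 2 = 2 * x 1 - i" "\<And>j. j < length bs \<Longrightarrow> m (j + 3) = 2 * x (j + 2)"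
    by (auto simp: m_def m_vec_def d)
  note v = I2_vec_m_vec[where x = x and i = i, OF n bs x, folded m_def]
  define e where "e j = (if bs ! j then x (j + 3) * x (j + 3) else (x (j + 2) - x (j + 3)) * (x (j +
      2) - x (j + 3)))" for j
  have "q powi e j * q_binom q (L * delta (j + 3) 1 + I2_vec n \<nu> m (j + 3) div 2) (m (j + 3)) =
     fermion_step (bs ! j) (x (j + 1)) (x (j + 2)) (x (j + 3))" if "j < length bs" for j
    unfolding v(3)[OF that] m(3)[OF that] by (simp add: e_def fermion_step_def algebra_simps)
  hence "(\<Prod>j<length bs. fermion_step (bs ! j) (x (j + 1)) (x (j + 2)) (x (j + 3))) =
      (\<Prod>j<length bs. q powi e j * q_binom q (L * delta (j + 3) 1 + I2_vec n \<nu> m (j + 3) div 2) (m (j + 3)))"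
    by (intro prod.cong) auto
  hence steps: "(\<Prod>j<length bs. fermion_step (bs ! j) (x (j + 1)) (x (j + 2)) (x (j + 3))) =
      q powi (\<Sum>j<length bs. e j) * (\<Prod>j<length bs. q_binom q (L * delta (j + 3) 1 + I2_vec n \<nu> m (j +
          3) div 2) (m (j + 3)))"
    by (simp only: q_power_int_sum prod.distrib finite_lessThan)
  have "fermi_term q n \<nu> L m = q powi (i * i - (x 1 + x 2) * i + (x 1 * x 1 + x 2 * x 2 +
      (\<Sum>j<length bs. e j))) *
      (q_binom q (L + (x 2 - x 1)) i * (q_binom q (x 1 - x 2) (2 * x 1 - i) *
       (\<Prod>j<length bs. q_binom q (L * delta (j + 3) 1 + I2_vec n \<nu> m (j + 3) div 2) (m (j + 3)))))"
    unfolding fermi_term_def m_def B2_form_m_vec[where x = x, OF n bs x] unfolding m_def[symmetric]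
    unfolding e_def d prod_add_2 v(1,2) m(1,2)
    by simp
  also have "L + (x 2 - x 1) = L - x 1 + x 2" by simp
  finally show ?thesis
    unfolding m_def[symmetric] steps using q_nonzero by (simp add: power_int_add mult_ac)
qed

text \<open>\<open>k\<close> counts the steps already unfolded into explicit coordinates. At
  \<open>k = length bs\<close> the remaining factor \<open>fermion []\<close> forces the last
  coordinate to be 0.\<close>

lemma fermion_chain:
  assumes "k \<le> length bs"
  shows "(\<Sum>x\<in>{1..k + 2} \<rightarrow>\<^sub>E {0..K}. f (x 1) (x 2) *
      (\<Prod>j<k. fermion_step (bs ! j) (x (j + 1)) (x (j + 2)) (x (j + 3))) * fermion (drop k bs) (x (k +
          1)) (x (k + 2)))
    = (\<Sum>a=0..K. \<Sum>b=0..K. f a b * fermion bs a b)"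
  using assms
proof (induction k)
  case 0
  have "{1..0 + 2} = insert 2 (insert (1::nat) {})" by auto
  thus ?case by (simp add: sum_PiE_insert)
next
  case (Suc k)
  let ?P = "\<lambda>x. f (x 1) (x 2) * (\<Prod>j<k. fermion_step (bs ! j) (x (j + 1)) (x (j + 2)) (x (j + 3)))"
  have ins: "{1..Suc k + 2} = insert (k + 3) {1..k + 2}" by auto
  have dr: "drop k bs = bs ! k # drop (Suc k) bs" using Suc.prems by (simp add: Cons_nth_drop_Suc)
  have "(\<Sum>x\<in>{1..Suc k + 2} \<rightarrow>\<^sub>E {0..K}. f (x 1) (x 2) *
      (\<Prod>j<Suc k. fermion_step (bs ! j) (x (j + 1)) (x (j + 2)) (x (j + 3))) *
      fermion (drop (Suc k) bs) (x (Suc k + 1)) (x (Suc k + 2))) =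
    (\<Sum>x\<in>{1..k + 2} \<rightarrow>\<^sub>E {0..K}. \<Sum>c=0..K. ?P x *
      (fermion_step (bs ! k) (x (k + 1)) (x (k + 2)) c * fermion (drop (Suc k) bs) (x (k + 2)) c))"
  proof -
    have "(\<Prod>j<k. fermion_step (bs ! j) ((x(k + 3 := c)) (j + 1)) ((x(k + 3 := c)) (j + 2)) ((x(k + 3 :=
        c)) (j + 3))) =
        (\<Prod>j<k. fermion_step (bs ! j) (x (j + 1)) (x (j + 2)) (x (j + 3)))" for x c
      by (intro prod.cong) auto
    thus ?thesis
      unfolding ins by (subst sum_PiE_insert) (auto simp: mult.assoc numeral_3_eq_3 intro!: sum.cong)
  qed
  also have "\<dots> = (\<Sum>x\<in>{1..k + 2} \<rightarrow>\<^sub>E {0..K}. ?P x * fermion (drop k bs) (x (k + 1)) (x (k + 2)))"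
  proof (intro sum.cong refl)
    fix x assume "x \<in> {1..k + 2} \<rightarrow>\<^sub>E {0..K}"
    hence "x (k + 2) \<in> {0..K}" by (rule PiE_mem) simp
    thus "(\<Sum>c=0..K. ?P x * (fermion_step (bs ! k) (x (k + 1)) (x (k + 2)) c *
        fermion (drop (Suc k) bs) (x (k + 2)) c)) =
        ?P x * fermion (drop k bs) (x (k + 1)) (x (k + 2))"
      unfolding dr sum_distrib_left[symmetric] by (subst fermion_Cons_atMost[of _ K]) auto
  qed
  also have "\<dots> = (\<Sum>a=0..K. \<Sum>b=0..K. f a b * fermion bs a b)"
    using Suc by simp
  finally show ?case .
qed

text \<open>Backwards from the final zero: with \<open>0 \<le> c \<le> b\<close>, either nonzero
  binomial of a step forces \<open>b \<le> a\<close>. The case \<open>k = 0\<close> gives the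
  inequality that the sum over \<open>m 1\<close> requires.\<close>

lemma fermion_steps_decreasing:
  assumes "(\<Prod>j<length bs. fermion_step (bs ! j) (x (j + 1)) (x (j + 2)) (x (j + 3))) \<noteq> 0"
    and "x (length bs + 2) = 0" "\<And>j. j \<in> {1..length bs + 2} \<Longrightarrow> (0::int) \<le> x j"
    and "k \<le> length bs"
  shows "x (k + 2) \<le> x (k + 1)"
  using assms(4)
proof (induction k rule: inc_induct)
  case base
  show ?case using assms(2,3) by simp
next
  case (step k)
  have "fermion_step (bs ! k) (x (k + 1)) (x (k + 2)) (x (k + 3)) \<noteq> 0" using assms(1) step.hyps by simp
  moreover have "x (k + 3) \<le> x (k + 2)" using step.IH by (simp add: numeral_3_eq_3)
  moreover have "0 \<le> x (k + 3)" using assms(3) step.hyps by simp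
  ultimately show ?case
    by (cases "bs ! k") (auto simp: fermion_step_def dest!: q_binom_nonzeroD)
qed

text \<open>Reflect the second binomial to lower entry \<open>k = i - (a + b)\<close>; the exponent
  becomes \<open>k * (k + (a + b))\<close>.\<close>

lemma q_vandermonde_m1:
  assumes "0 \<le> b" "b \<le> a" "a \<le> L"
  shows "(\<Sum>i=0..L. q powi (i * i - (a + b) * i) * q_binom q (L - a + b) i * q_binom q (a - b) (2 * a - i)) =
    q_binom q L (2 * a)"
proof -
  have "(\<Sum>i=0..L. q powi (i * i - (a + b) * i) * q_binom q (L - a + b) i * q_binom q (a - b) (2 * a - i)) =
    (\<Sum>i=a + b..2 * a. q powi (i * i - (a + b) * i) * q_binom q (L - a + b) i * q_binom q (a - b) (2 * a - i))"
    using assms by (intro sum.mono_neutral_cong) (auto simp: q_binom_def)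
  also have "\<dots> = (\<Sum>k=0..a - b. q powi (k * (k + (a + b))) * q_binom q (a - b) k * q_binom q (L - a + b) (k +
      (a + b)))"
  proof (rule sum.reindex_bij_witness[of _ "\<lambda>k. k + (a + b)" "\<lambda>i. i - (a + b)"])
    fix i
    have "q_binom q (a - b) (a - b - (i - (a + b))) = q_binom q (a - b) (i - (a + b))" by (rule q_binom_sym)
    moreover have "a - b - (i - (a + b)) = 2 * a - i" "i - (a + b) + (a + b) = i"
      "(i - (a + b)) * i = i * i - (a + b) * i" by (simp_all add: algebra_simps)
    ultimately show "q powi ((i - (a + b)) * (i - (a + b) + (a + b))) * q_binom q (a - b) (i - (a + b)) *
        q_binom q (L - a + b) (i - (a + b) + (a + b)) =
      q powi (i * i - (a + b) * i) * q_binom q (L - a + b) i * q_binom q (a - b) (2 * a - i)"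
      by (simp add: mult_ac)
  qed auto
  also have "\<dots> = q_binom q (a - b + (L - a + b)) (a - b + (a + b))"
    using assms by (intro q_vandermonde) auto
  also have "\<dots> = q_binom q L (2 * a)" by simp
  finally show ?thesis .
qed

text \<open>The support bound \<open>0 \<le> m j \<le> L\<close> places all nonzero terms in the
  injective image of a finite box of pairs \<open>(i, x)\<close>. Summing over \<open>i\<close>
  first leaves the weights of \<open>fermion_chain\<close>.\<close>

lemma sum_fermi_term_eq_fermion:
  assumes exp: "cfrac_expansion y n \<nu>" "y < 2" and bs: "cf_turns n \<nu> = True # bs"
  shows "sum' (fermi_term q n \<nu> L) (m_index n \<nu>) =
    (\<Sum>a=0..L. \<Sum>b=0..L. q_binom q L (2 * a) * (q powi (a * a) * q powi (b * b)) * fermion bs a b)"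
proof -
  have n: "1 \<le> n" "\<nu> 0 = 1" "\<forall>i<n. 1 \<le> \<nu> i"
    using cfrac_expansion_lt_2[OF exp] exp(1) by (auto simp: cfrac_expansion_def)
  note d = dim2_bs[OF n bs]
  let ?l = "length bs"
  define N where "N = {x \<in> {1..?l + 2} \<rightarrow>\<^sub>E {0..L}. x (?l + 2) = 0}"
  have finN: "finite N" unfolding N_def by (rule finite_subset[OF _ finite_PiE[of "{1..?l +
      2}" "\<lambda>_. {0..L}"]]) auto
  define \<psi> where "\<psi> = (\<lambda>(i, x). m_vec (dim2 n \<nu>) i x)"
  have inj: "inj_on \<psi> ({0..L} \<times> N)"
  proof (rule inj_onI, clarify)
    fix i i' :: int and x x' assume x: "x \<in> N" "x' \<in> N" and eq: "\<psi> (i, x) = \<psi> (i', x')"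
    have e: "m_vec (dim2 n \<nu>) i x j = m_vec (dim2 n \<nu>) i' x' j" for j using eq by (simp add: \<psi>_def)
    have i: "i = i'" using e[of 1] by (simp add: m_vec_def d)
    moreover have "x = x'"
    proof
      fix j
      consider "j = 1" | "j = ?l + 2" | "2 \<le> j" "j \<le> ?l + 1" | "j \<notin> {1..?l + 2}" by fastforce
      thus "x j = x' j"
      proof cases
        case 1
        thus ?thesis using e[of 2] i by (simp add: m_vec_def d)
      next
        case 2
        thus ?thesis using x by (simp add: N_def)
      next
        case 3
        thus ?thesis using e[of "Suc j"] by (simp add: m_vec_def d)
      next
        case 4
        thus ?thesis using x PiE_arb[of x "{1..?l + 2}" "\<lambda>_. {0..L}" j] PiE_arb[of x' "{1..?l +
            2}" "\<lambda>_. {0..L}" j]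
          by (simp add: N_def)
      qed
    qed
    ultimately show "i = i' \<and> x = x'" by simp
  qed
  have sub: "\<psi> ` ({0..L} \<times> N) \<subseteq> m_index n \<nu>"
    by (auto simp: \<psi>_def m_index_def m_vec_def d)
  have supp: "m \<in> \<psi> ` ({0..L} \<times> N)" if m: "m \<in> m_index n \<nu>" "fermi_term q n \<nu> L m \<noteq> 0" for m
  proof -
    have range: "m j \<in> {0..L}" if "j \<in> {1..dim2 n \<nu>}" for j
      using fermi_term_support[OF exp m(2) that] .
    have r: "0 \<le> m 1" "m 1 \<le> L" "0 \<le> m 2" "m 2 \<le> L" using range[of 1] range[of 2] by (auto simp: d)
    have ev: "even (m 1 + m 2)" "\<And>j. 3 \<le> j \<Longrightarrow> j \<le> ?l + 2 \<Longrightarrow> even (m j)" using m(1) by (auto simp: m_index_def d)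
    define x where "x = (\<lambda>j\<in>{1..?l + 2}. if j = 1 then (m 1 + m 2) div 2 else if j = ?l + 2 then 0 else m (j
        + 1) div 2)"
    have "x j \<in> {0..L}" if "j \<in> {1..?l + 2}" for j
      using range[of "j + 1"] r that by (auto simp: x_def d)
    hence "x \<in> N" by (auto simp: N_def x_def)
    moreover have "m = \<psi> (m 1, x)"
    proof
      fix j
      have ar: "j \<notin> {1..dim2 n \<nu>} \<Longrightarrow> m j = undefined" using m(1) by (auto simp: m_index_def)
      consider "j = 1" | "j = 2" | "3 \<le> j" "j \<le> ?l + 2" | "j \<notin> {1..dim2 n \<nu>}" by (fastforce simp: d)
      thus "m j = \<psi> (m 1, x) j"
      proof cases
        case 3
        hence "2 * (m j div 2) = m j" using ev(2) by simp
        thus ?thesis using 3 by (auto simp: \<psi>_def m_vec_def x_def d)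
      next
        case 4
        thus ?thesis using ar by (auto simp: \<psi>_def m_vec_def)
      qed (use ev(1) in \<open>auto simp: \<psi>_def m_vec_def x_def d\<close>)
    qed
    moreover have "m 1 \<in> {0..L}" using r by simp
    ultimately show ?thesis by blast
  qed
  define W where "W x = q powi (x 1 * x 1) * q powi (x 2 * x 2) *
      (\<Prod>j<?l. fermion_step (bs ! j) (x (j + 1)) (x (j + 2)) (x (j + 3)))" for x
  have term_W: "fermi_term q n \<nu> L (\<psi> (i, x)) =
      q powi (i * i - (x 1 + x 2) * i) * q_binom q (L - x 1 + x 2) i * q_binom q (x 1 - x 2) (2 * x 1 - i) *
          W x"
    if "x \<in> N" for i x
    using that unfolding \<psi>_def prod.case W_def by (intro fermi_term_m_vec[OF n bs]) (simp add: N_def)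
  \<comment> \<open>If \<open>W x\<close> is 0 both sides vanish; otherwise
    \<open>x 2 \<le> x 1\<close> and the Vandermonde sum applies.\<close>
  have inner: "(\<Sum>i=0..L. fermi_term q n \<nu> L (\<psi> (i, x))) = q_binom q L (2 * x 1) * W x" if x: "x \<in> N" for x
  proof (cases "W x = 0")
    case True
    thus ?thesis by (simp add: term_W[OF x])
  next
    case False
    have xr: "0 \<le> x j \<and> x j \<le> L" if "j \<in> {1..?l + 2}" for j
      using x PiE_mem[of x "{1..?l + 2}" "\<lambda>_. {0..L}" j] that by (auto simp: N_def)
    have "x (0 + 2) \<le> x (0 + 1)"
      using False x xr by (intro fermion_steps_decreasing[of bs]) (auto simp: W_def N_def)
    hence le: "x 2 \<le> x 1" by (simp add: numeral_2_eq_2)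
    have "(\<Sum>i=0..L. fermi_term q n \<nu> L (\<psi> (i, x))) =
      (\<Sum>i=0..L. q powi (i * i - (x 1 + x 2) * i) * q_binom q (L - x 1 + x 2) i * q_binom q (x 1 - x 2) (2 *
          x 1 - i) * W x)"
      unfolding term_W[OF x] ..
    also have "\<dots> = q_binom q L (2 * x 1) * W x"
      unfolding sum_distrib_right[symmetric] using le xr[of 1] xr[of 2] by (subst q_vandermonde_m1) auto
    finally show ?thesis .
  qed
  have "sum' (fermi_term q n \<nu> L) (m_index n \<nu>) = sum' (fermi_term q n \<nu> L) (\<psi> ` ({0..L} \<times> N))"
    using sub supp by (intro sum.mono_neutral_right') auto
  also have "\<dots> = (\<Sum>m\<in>\<psi> ` ({0..L} \<times> N). fermi_term q n \<nu> L m)" using finN by (intro sum.eq_sum) auto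
  also have "\<dots> = (\<Sum>(i, x)\<in>{0..L} \<times> N. fermi_term q n \<nu> L (\<psi> (i, x)))"
    by (subst sum.reindex[OF inj]) (simp add: case_prod_unfold)
  also have "\<dots> = (\<Sum>i=0..L. \<Sum>x\<in>N. fermi_term q n \<nu> L (\<psi> (i, x)))" by (simp add: sum.cartesian_product)
  also have "\<dots> = (\<Sum>x\<in>N. \<Sum>i=0..L. fermi_term q n \<nu> L (\<psi> (i, x)))" by (rule sum.swap)
  also have "\<dots> = (\<Sum>x\<in>N. q_binom q L (2 * x 1) * W x)" by (simp add: inner)
  \<comment> \<open>\<open>drop ?l bs\<close> is empty, so its \<open>fermion\<close> is the
    indicator of \<open>x (?l + 2) = 0\<close> and restricts the full box to
    \<open>N\<close>.\<close>
  also have "\<dots> = (\<Sum>x\<in>{1..?l + 2} \<rightarrow>\<^sub>E {0..L}. q_binom q L (2 * x 1) * (q powi (x 1 * x 1) * q powi (x 2 * x 2)) *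
      (\<Prod>j<?l. fermion_step (bs ! j) (x (j + 1)) (x (j + 2)) (x (j + 3))) * fermion (drop ?l bs) (x (?l +
          1)) (x (?l + 2)))"
    by (rule sum.mono_neutral_cong_left) (auto simp: N_def W_def mult.assoc intro!: finite_PiE)
  also have "\<dots> = (\<Sum>a=0..L. \<Sum>b=0..L. q_binom q L (2 * a) * (q powi (a * a) * q powi (b * b)) * fermion bs a b)"
    by (rule fermion_chain[where f = "\<lambda>a b. q_binom q L (2 * a) * (q powi (a * a) * q powi (b * b))"]) simp
  finally show ?thesis .
qed

end

section \<open>The identity for an indeterminate\<close>

lemma generic_q_fls_X: "generic_q (fls_X :: 'a::field fls)"
proof
  fix n :: nat assume "0 < n"
  hence "fls_nth (fls_X ^ n :: 'a fls) 0 \<noteq> fls_nth 1 0" by (simp add: fls_X_power_nth)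
  thus "(fls_X :: 'a fls) ^ n \<noteq> 1" by metis
qed simp

theorem proposition4p3:
  fixes p p' r s L :: int and n :: nat and \<nu> :: "nat \<Rightarrow> nat" and q :: "rat fls"
  assumes "q = fls_X"
    and "1 < p" and "p < p'" and "p' < 2 * p" and "gcd p p' = 1"
    and "1 \<le> r" and "r < p" and "1 \<le> s" and "s < p'" and "\<bar>p' * r - p * s\<bar> = 1"
    and "cfrac_expansion (of_int p' / of_int p) n \<nu>"
  shows "sum' (fermi_term q n \<nu> L) (m_index n \<nu>) = sum' (bose_term q p p' r s L) UNIV"
proof -
  interpret generic_q q unfolding assms(1) by (rule generic_q_fls_X)
  have lt2: "(of_int p' / of_int p :: rat) < 2"
  proof -
    have "of_int p' < (of_int (2 * p) :: rat)" using assms(4) by (simp only: of_int_less_iff)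
    thus ?thesis using assms(2) by (simp add: divide_less_eq)
  qed
  note n = cfrac_expansion_lt_2[OF assms(11) lt2]
  obtain n' where "n = Suc n'" using n(1) by (cases n) auto
  \<comment> \<open>Since \<open>\<nu> 0 = 1\<close>, no \<open>False\<close> precedes the first
    turn.\<close>
  hence bs: "cf_turns n \<nu> = True # cf_turns n' (\<lambda>i. \<nu> (Suc i))" using n(2) by simp
  define bs where "bs = cf_turns n' (\<lambda>i. \<nu> (Suc i))"
  note bs = bs[folded bs_def]
  have P: "turn_pair (True # bs) (2, 1) = (p', p)" using turn_pair_top[OF assms(11)] assms(2,5) bs by simp
  obtain e where e: "e \<in> {0, 1}" "turn_pair (True # bs) (1, e) = (s, r)"
    using turn_pair_unique[OF P assms(5,6,7,10)] by auto
  \<comment> \<open>For \<open>K < \<bar>j\<bar>\<close> also \<open>K < \<bar>p' * j\<bar>\<close>,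
    and the summand \<open>2 * \<bar>s\<bar>\<close> absorbs the shift by \<open>2 * s\<close>, so
    both trinomials vanish outside \<open>{-K..K}\<close>.\<close>
  define K where "K = \<bar>L\<bar> + 2 * \<bar>s\<bar> + 1"
  have "bose_term q p p' r s L j = 0" if "j \<notin> {-K..K}" for j
  proof -
    have "K < \<bar>j\<bar>" using that by auto
    moreover have "1 * \<bar>j\<bar> \<le> p' * \<bar>j\<bar>" using assms(2,3) by (intro mult_right_mono) auto
    moreover have "p' * \<bar>j\<bar> = \<bar>p' * j\<bar>" using assms(2,3) by (simp add: abs_mult)
    ultimately have "K < \<bar>p' * j\<bar>" by simp
    hence "L < \<bar>2 * p' * j\<bar>" "L < \<bar>2 * p' * j + 2 * s\<bar>" unfolding K_def mult.assoc by linarith+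
    thus ?thesis by (simp add: bose_term_def q_trinom2_eq_0)
  qed
  hence "sum' (bose_term q p p' r s L) UNIV = sum' (bose_term q p p' r s L) {-K..K}"
    by (intro sum.mono_neutral_right') auto
  also have "\<dots> = (\<Sum>j=-K..K. bose_term q p p' r s L j)" by (simp add: sum.eq_sum)
  also have "\<dots> = (\<Sum>a=0..L. \<Sum>b=0..L. q_binom q L (2 * a) * (q powi (a * a) * q powi (b * b)) * fermion bs a b)"
    using P e by (intro sum_bose_term_eq_fermion) (auto simp: K_def)
  also have "\<dots> = sum' (fermi_term q n \<nu> L) (m_index n \<nu>)"
    using sum_fermi_term_eq_fermion[OF assms(11) lt2 bs] by simp
  finally show ?thesis by simp
qed

end
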